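(* Let $K$ be an algebraically closed field complete with respect to a non-trivial non-archimedean absolute value $|\cdot|$, with residue characteristic $p\geq0$, let $d\geq 2$, and assume $\operatorname{char}K=0$ or $\operatorname{char}K>d$. Let $\epsilon=\min\{|m|^d:1\leq m\leq d\}$. Let $\varphi\in K(z)$ be a rational function of degree $d$ with $\varphi(\infty)=\infty$, and let $a\in K$ be a point which is not a pole of $\varphi$. Let $r$ be the radius of the largest punctured disk $\{x\in K:0<|x-a|<r\}$ which is disjoint from $\varphi^{-1}(\{\varphi(a),\infty\})$. Then there is a critical point $\beta$ of $\varphi$ satisfying $|\varphi(\beta)-\varphi(a)|\leq\epsilon^{-1}r|\varphi'(a)|$.
   Context: Here $|m|$ denotes the absolute value in $K$ of the integer $m$; critical points are points of $\mathbb{P}^1(K)$ at which $\varphi$ is not locally injective (for finite points not mapping to $\infty$, zeros of $\varphi'$). *)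

theory Defs
  imports
    "HOL-Computational_Algebra.Computational_Algebra"
    "HOL-Analysis.Abstract_Metric_Spaces"
    "HOL-Library.Extended_Real"
begin

section \<open>Non-archimedean absolute values\<close>

locale nonarch_absolute_value =
  fixes absv :: "'a::field \<Rightarrow> real"
  assumes absv_nonneg: "0 \<le> absv x"
    and absv_eq_0_iff: "absv x = 0 \<longleftrightarrow> x = 0"
    and absv_mult: "absv (x * y) = absv x * absv y"
    and absv_ultrametric: "absv (x + y) \<le> max (absv x) (absv y)"
    and absv_nontrivial: "\<exists>x. x \<noteq> 0 \<and> absv x \<noteq> 1"
begin

lemma absv_one: "absv 1 = 1"
  using absv_mult[of 1 1] absv_eq_0_iff[of 1] by simp

lemma absv_uminus: "absv (- x) = absv x"
proof -
  have "absv (- 1) * absv (- 1) = 1"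
    using absv_mult[of "- 1" "- 1"] absv_one by simp
  then have "absv (- 1) = 1"
    using absv_nonneg[of "- 1"] by (auto simp: square_eq_1_iff)
  then show ?thesis
    using absv_mult[of "- 1" x] by simp
qed

lemma Metric_space_absv: "Metric_space UNIV (\<lambda>x y. absv (x - y))"
proof
  fix x y z :: 'a
  show "absv (x - y) = absv (y - x)"
    using absv_uminus[of "x - y"] by simp
  show "absv (x - z) \<le> absv (x - y) + absv (y - z)"
    using absv_ultrametric[of "x - y" "y - z"] absv_nonneg[of "x - y"] absv_nonneg[of "y - z"]
    by simp
qed (simp_all add: absv_nonneg absv_eq_0_iff)

end

locale complete_nonarch_absolute_value = nonarch_absolute_value +
  assumes absv_complete: "Metric_space.mcomplete UNIV (\<lambda>x y. absv (x - y))"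


section \<open>Rational functions\<close>

text \<open>
  The field \<open>K(z)\<close> is the type \<open>'a poly fract\<close>. The function \<^term>\<open>quot_of_fract\<close> of the library
  needs a gcd operation on the coefficient field, so a representation in lowest terms
  is chosen here for an arbitrary field; it is unique up to a common constant factor.
\<close>

definition rat_quot :: "'a::field poly fract \<Rightarrow> 'a poly \<times> 'a poly" where
  "rat_quot \<phi> = (SOME (P, Q). Q \<noteq> 0 \<and> coprime P Q \<and> \<phi> = Fract P Q)"

definition rat_num :: "'a::field poly fract \<Rightarrow> 'a poly" where
  "rat_num \<phi> = fst (rat_quot \<phi>)"

definition rat_den :: "'a::field poly fract \<Rightarrow> 'a poly" where
  "rat_den \<phi> = snd (rat_quot \<phi>)"

lemma rat_lowest_terms_exist:
  fixes \<phi> :: "'a::field poly fract"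
  shows "\<exists>P Q. Q \<noteq> 0 \<and> coprime P Q \<and> \<phi> = Fract P Q"
proof -
  let ?R = "\<lambda>n. \<exists>P Q. Q \<noteq> 0 \<and> \<phi> = Fract P Q \<and> degree Q = n"
  have "\<exists>n. ?R n"
    by (cases \<phi> rule: Fract_cases) blast
  then have "?R (LEAST n. ?R n)"
    by (rule LeastI_ex)
  then obtain P Q where PQ: "Q \<noteq> 0" "\<phi> = Fract P Q" and deg: "degree Q = (LEAST n. ?R n)"
    by blast
  have "coprime P Q"
  proof (rule coprimeI)
    fix c assume "c dvd P" "c dvd Q"
    then obtain P' Q' where P': "P = c * P'" and Q': "Q = c * Q'"
      by (auto elim!: dvdE)
    with PQ have nz: "c \<noteq> 0" "Q' \<noteq> 0" by auto
    have "\<phi> = Fract P' Q'"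
      using PQ nz by (simp add: P' Q' eq_fract mult_ac)
    with nz have "(LEAST n. ?R n) \<le> degree Q'"
      by (intro Least_le) blast
    moreover have "degree Q = degree c + degree Q'"
      using nz by (simp add: Q' degree_mult_eq)
    ultimately have "degree c = 0" using deg by linarith
    with nz show "is_unit c" by (simp add: is_unit_iff_degree)
  qed
  with PQ show ?thesis by blast
qed

lemma
  fixes \<phi> :: "'a::field poly fract"
  shows rat_den_nonzero: "rat_den \<phi> \<noteq> 0"
    and rat_coprime: "coprime (rat_num \<phi>) (rat_den \<phi>)"
    and Fract_rat_num_den: "Fract (rat_num \<phi>) (rat_den \<phi>) = \<phi>"
proof -
  have "case rat_quot \<phi> of (P, Q) \<Rightarrow> Q \<noteq> 0 \<and> coprime P Q \<and> \<phi> = Fract P Q"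
    unfolding rat_quot_def by (rule someI_ex) (use rat_lowest_terms_exist[of \<phi>] in auto)
  then show "rat_den \<phi> \<noteq> 0" "coprime (rat_num \<phi>) (rat_den \<phi>)"
    "Fract (rat_num \<phi>) (rat_den \<phi>) = \<phi>"
    by (auto simp: rat_num_def rat_den_def split: prod.splits)
qed

definition rat_degree :: "'a::field poly fract \<Rightarrow> nat" where
  "rat_degree \<phi> = max (degree (rat_num \<phi>)) (degree (rat_den \<phi>))"

text \<open>The value at a point of \<open>K\<close>; meaningful only away from the poles.\<close>

definition rat_eval :: "'a::field poly fract \<Rightarrow> 'a \<Rightarrow> 'a" where
  "rat_eval \<phi> x = poly (rat_num \<phi>) x / poly (rat_den \<phi>) x"

definition rat_deriv :: "'a::field poly fract \<Rightarrow> 'a poly fract" where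
  "rat_deriv \<phi> =
     Fract (pderiv (rat_num \<phi>) * rat_den \<phi> - rat_num \<phi> * pderiv (rat_den \<phi>)) ((rat_den \<phi>)\<^sup>2)"

lemma rat_eval_Fract:
  assumes "poly Q x \<noteq> 0"
  shows "poly (rat_den (Fract P Q)) x \<noteq> 0" "rat_eval (Fract P Q) x = poly P x / poly Q x"
proof -
  let ?N = "rat_num (Fract P Q)" and ?D = "rat_den (Fract P Q)"
  have Q: "Q \<noteq> 0" using assms by auto
  have "?N * Q = P * ?D"
    using Fract_rat_num_den[of "Fract P Q"] Q rat_den_nonzero[of "Fract P Q"]
    by (simp add: eq_fract)
  then have eq: "poly ?N x * poly Q x = poly P x * poly ?D x"
    by (metis poly_mult)
  show D: "poly ?D x \<noteq> 0"
  proof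
    assume D0: "poly ?D x = 0"
    with eq assms have "poly ?N x = 0" by simp
    with D0 have "is_unit [:- x, 1:]"
      using rat_coprime[of "Fract P Q"] by (meson coprime_common_divisor poly_eq_0_iff_dvd)
    then show False by (simp add: is_unit_iff_degree)
  qed
  from D assms eq show "rat_eval (Fract P Q) x = poly P x / poly Q x"
    by (simp add: rat_eval_def field_simps)
qed


section \<open>The projective line\<close>

datatype 'a proj_line = Fin 'a | Infty

fun rat_map :: "'a::field poly fract \<Rightarrow> 'a proj_line \<Rightarrow> 'a proj_line" where
  "rat_map \<phi> (Fin x) = (if poly (rat_den \<phi>) x = 0 then Infty else Fin (rat_eval \<phi> x))"
| "rat_map \<phi> Infty =
     (if degree (rat_num \<phi>) > degree (rat_den \<phi>) then Infty
      else Fin (coeff (rat_num \<phi>) (degree (rat_den \<phi>)) / lead_coeff (rat_den \<phi>)))"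

text \<open>
  The sets \<open>proj_ball absv \<beta> e\<close> with \<open>e > 0\<close> form a neighbourhood basis at \<open>\<beta>\<close> of the topology of
  the projective line: discs around finite points, complements of discs together with
  infinity at infinity.
\<close>

fun proj_ball :: "('a::field \<Rightarrow> real) \<Rightarrow> 'a proj_line \<Rightarrow> real \<Rightarrow> 'a proj_line set" where
  "proj_ball absv (Fin b) e = Fin ` {x. absv (x - b) < e}"
| "proj_ball absv Infty e = insert Infty (Fin ` {x. absv x > 1 / e})"

definition locally_injective_at ::
    "('a::field \<Rightarrow> real) \<Rightarrow> ('a proj_line \<Rightarrow> 'b) \<Rightarrow> 'a proj_line \<Rightarrow> bool" where
  "locally_injective_at absv f \<beta> \<longleftrightarrow> (\<exists>e>0. inj_on f (proj_ball absv \<beta> e))"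

definition critical_point ::
    "('a::field \<Rightarrow> real) \<Rightarrow> 'a poly fract \<Rightarrow> 'a proj_line \<Rightarrow> bool" where
  "critical_point absv \<phi> \<beta> \<longleftrightarrow> \<not> locally_injective_at absv (rat_map \<phi>) \<beta>"


section \<open>Punctured discs\<close>

definition punctured_disk :: "('a::field \<Rightarrow> real) \<Rightarrow> 'a \<Rightarrow> ereal \<Rightarrow> 'a set" where
  "punctured_disk absv a s = {x. 0 < absv (x - a) \<and> ereal (absv (x - a)) < s}"

text \<open>
  The radius is extended real: it is infinite if \<open>a\<close> is the only point of \<open>K\<close> in the
  preimage, as for \<open>\<phi> = (z - a)^d\<close>. In that case \<open>\<phi>'(a) = 0\<close>, and products \<open>\<infinity> * 0\<close> are \<open>0\<close> in
  \<^typ>\<open>ereal\<close>. The supremum is attained, see \<open>punctured_disk_largest_radius\<close>.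
\<close>

definition largest_radius :: "('a::field \<Rightarrow> real) \<Rightarrow> 'a poly fract \<Rightarrow> 'a \<Rightarrow> ereal" where
  "largest_radius absv \<phi> a =
     Sup {s. Fin ` punctured_disk absv a s \<inter> rat_map \<phi> -` {rat_map \<phi> (Fin a), Infty} = {}}"

lemma punctured_disk_largest_radius:
  "Fin ` punctured_disk absv a (largest_radius absv \<phi> a)
     \<inter> rat_map \<phi> -` {rat_map \<phi> (Fin a), Infty} = {}"
  by (fastforce simp: largest_radius_def punctured_disk_def less_Sup_iff)

end

theory Submission
  imports Defs
begin

text \<open>
  Write \<open>\<phi> - \<phi>(a) = P / Q\<close>, \<open>s = r |\<phi>'(a)|\<close> and \<open>\<mu> = min |m|\<close>, and suppose that all finite critical
  values of \<open>P / Q\<close> exceed \<open>s / \<mu>\<^sup>d\<close> in absolute value. Then the zeros \<open>x\<close> of \<open>P\<close> are simple. Choose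
  \<open>w\<close> with \<open>t = |w|\<close> slightly larger than \<open>s / \<mu>\<^sup>d\<close> and let \<open>z\<close> run through the \<open>d\<close> roots of
  \<open>P - w Q\<close>. The product of the \<open>|\<phi>'(z)|\<close> equals the product of the \<open>|\<phi>'(x)|\<close>, because the
  discriminant of \<open>P - w Q\<close> as a polynomial in \<open>w\<close> has no zeros of absolute value at most \<open>t\<close>.

  On the one hand \<open>|\<phi>'(z)| \<delta>(z) \<ge> \<mu> t\<close>, where \<open>\<delta>(z)\<close> is the distance from \<open>z\<close> to the zeros of
  \<open>P\<close>: around \<open>z\<close>, \<open>|\<phi> - \<phi>(a)|\<close> grows like a power \<open>n\<close> of the radius with \<open>1 \<le> |n| \<le> d\<close>, and
  the derivative picks up the factor \<open>n\<close>. On the other hand, successive attachment of the zeros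
  of \<open>P\<close> turns the product of the \<open>|\<phi>'(x)| \<delta>(z) / t\<close> into a product of \<open>d - 1\<close> factors
  \<open>min(1, F / t)\<close>, where \<open>F\<close> is the generic value of \<open>|\<phi> - \<phi>(a)|\<close> on the sphere around a zero through
  the closest zero attached before. Attaching first to \<open>a\<close> the zero closest to \<open>a\<close> gives a factor
  with \<open>F \<le> s\<close>. Hence \<open>\<mu>\<^sup>d \<le> s / t\<close>, a contradiction.
\<close>

section \<open>Roots and derivatives of polynomials\<close>

lemma prod_mset_nonneg:
  fixes f :: "'a \<Rightarrow> real"
  shows "(\<And>x. x \<in># A \<Longrightarrow> 0 \<le> f x) \<Longrightarrow> 0 \<le> (\<Prod>x\<in>#A. f x)"
  by (induction A) auto

lemma prod_mset_mono_nonneg: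
  fixes f g :: "'a \<Rightarrow> real"
  assumes "\<And>x. x \<in># A \<Longrightarrow> 0 \<le> f x" "\<And>x. x \<in># A \<Longrightarrow> f x \<le> g x"
  shows "(\<Prod>x\<in>#A. f x) \<le> (\<Prod>x\<in>#A. g x)"
  using assms
proof (induction A)
  case (add x A)
  then have "0 \<le> f x" "f x \<le> g x" "0 \<le> (\<Prod>x\<in>#A. f x)" "(\<Prod>x\<in>#A. f x) \<le> (\<Prod>x\<in>#A. g x)"
    by (auto intro: prod_mset_nonneg)
  then show ?case by (simp add: mult_mono)
qed simp

lemma sum_mset_diff_fun:
  fixes f g :: "'a \<Rightarrow> 'b::ab_group_add"
  shows "(\<Sum>x\<in>#A. f x - g x) = (\<Sum>x\<in>#A. f x) - (\<Sum>x\<in>#A. g x)"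
  by (induction A) simp_all

lemma proots_prod_linear_factors:
  fixes p :: "'a::alg_closed_field poly"
  assumes "p \<noteq> 0"
  shows "p = smult (lead_coeff p) (\<Prod>x\<in>#proots p. [:- x, 1:])" "size (proots p) = degree p"
proof -
  obtain A where A: "size A = degree p" "p = smult (lead_coeff p) (\<Prod>x\<in>#A. [:- x, 1:])"
    using alg_closed_imp_factorization[OF assms] by blast
  have "proots (\<Prod>x\<in>#A. [:- x, 1:]) = A"
  proof (induction A)
    case (add x A)
    have "(\<Prod>x\<in>#A. [:- x, 1:]) \<noteq> 0" by auto
    with add show ?case by (simp add: proots_mult del: mult_pCons_left)
  qed simp
  then have "proots p = A"
    using assms by (subst A(2)) (simp add: proots_smult)
  with A show "p = smult (lead_coeff p) (\<Prod>x\<in>#proots p. [:- x, 1:])" "size (proots p) = degree p"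
    by auto
qed

lemma poly_prod_proots:
  fixes p :: "'a::alg_closed_field poly"
  assumes "p \<noteq> 0"
  shows "poly p z = lead_coeff p * (\<Prod>x\<in>#proots p. z - x)"
  by (subst proots_prod_linear_factors(1)[OF assms]) (simp add: poly_prod_mset)

lemma pderiv_prod_linear_factors:
  fixes A :: "'a::field multiset"
  assumes "z \<notin># A"
  shows "poly (pderiv (\<Prod>x\<in>#A. [:- x, 1:])) z =
    poly (\<Prod>x\<in>#A. [:- x, 1:]) z * (\<Sum>x\<in>#A. 1 / (z - x))"
  using assms
proof (induction A)
  case (add x A)
  let ?q = "\<Prod>x\<in>#A. [:- x, 1:]"
  have "poly (pderiv (\<Prod>x\<in>#add_mset x A. [:- x, 1:])) z =
      poly ?q z + (z - x) * poly (pderiv ?q) z"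
    by (simp add: pderiv_mult pderiv_pCons del: mult_pCons_left)
  moreover have "poly (\<Prod>x\<in>#add_mset x A. [:- x, 1:]) z = (z - x) * poly ?q z"
    by (simp add: left_diff_distrib)
  moreover have "poly (pderiv ?q) z = poly ?q z * (\<Sum>x\<in>#A. 1 / (z - x))" "z \<noteq> x"
    using add by auto
  ultimately show ?case by (simp add: distrib_left del: image_mset_add_mset)
qed simp

lemma log_pderiv_proots:
  fixes p :: "'a::alg_closed_field poly"
  assumes "poly p z \<noteq> 0"
  shows "poly (pderiv p) z / poly p z = (\<Sum>x\<in>#proots p. 1 / (z - x))"
proof -
  have p: "p \<noteq> 0" using assms by auto
  have "z \<notin># proots p" using assms p by simp
  from pderiv_prod_linear_factors[OF this] show ?thesis
    using assms p
    by (subst (asm) proots_prod_linear_factors(1)[OF p], subst (1 2) proots_prod_linear_factors(1)[OF p])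
       (simp add: pderiv_smult)
qed

text \<open>The numerator of \<open>(P / Q)'\<close> over \<open>Q\<^sup>2\<close>.\<close>

definition wronskian :: "'a::idom poly \<Rightarrow> 'a poly \<Rightarrow> 'a poly" where
  "wronskian P Q = pderiv P * Q - P * pderiv Q"

lemma poly_wronskian:
  "poly (wronskian P Q) z = poly (pderiv P) z * poly Q z - poly P z * poly (pderiv Q) z"
  by (simp add: wronskian_def)

lemma degree_monom_diff_const:
  assumes "N > 0"
  shows "degree (monom (1 :: 'a::comm_ring_1) N - [:c:]) = N"
  unfolding diff_conv_add_uminus using assms by (subst degree_add_eq_left) (simp_all add: degree_monom_eq)

text \<open>Since \<open>v / (v - c) = 1 - c / (c - v)\<close>, the sum reduces to the logarithmic
  derivative of \<open>X\<^sup>N - u\<^sup>N\<close> at \<open>c\<close>. It is the averaging device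
  for counting zeros and poles inside a sphere.\<close>

lemma sum_roots_of_power:
  fixes u c :: "'a::alg_closed_field"
  assumes "N > 0" "c ^ N \<noteq> u ^ N"
  shows "(\<Sum>v\<in>#proots (monom 1 N - [:u ^ N:]). v / (v - c)) = of_nat N * (u ^ N / (u ^ N - c ^ N))"
proof -
  let ?p = "monom 1 N - [:u ^ N:]"
  have deg: "degree ?p = N" using assms by (intro degree_monom_diff_const)
  then have p: "?p \<noteq> 0" using assms by auto
  have ev: "poly ?p v = v ^ N - u ^ N" for v by (simp add: poly_monom)
  have size: "size (proots ?p) = N" using proots_prod_linear_factors(2)[OF p] deg by simp
  have root: "v ^ N = u ^ N" if "v \<in># proots ?p" for v
    using that p ev[of v] by simp
  have "(\<Sum>v\<in>#proots ?p. v / (v - c)) = (\<Sum>v\<in>#proots ?p. 1 - c * (1 / (c - v)))"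
  proof (intro arg_cong[of _ _ sum_mset] image_mset_cong)
    fix v assume "v \<in># proots ?p"
    then have "v \<noteq> c" using root assms by metis
    then show "v / (v - c) = 1 - c * (1 / (c - v))" by (simp add: divide_simps) (simp add: algebra_simps)
  qed
  also have "\<dots> = of_nat N - c * (\<Sum>v\<in>#proots ?p. 1 / (c - v))"
    using size by (simp add: sum_mset_diff_fun sum_mset_distrib_left)
  also have "(\<Sum>v\<in>#proots ?p. 1 / (c - v)) = of_nat N * c ^ (N - 1) / (c ^ N - u ^ N)"
    using log_pderiv_proots[of ?p c] assms ev[of c]
    by (simp add: pderiv_diff pderiv_monom poly_monom)
  also have "of_nat N - c * (of_nat N * c ^ (N - 1) / (c ^ N - u ^ N)) =
      of_nat N - of_nat N * (c ^ N / (c ^ N - u ^ N))"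
    using assms power_minus_mult[of N c] by (simp add: mult_ac)
  also have "\<dots> = of_nat N * (u ^ N / (u ^ N - c ^ N))"
    using assms by (simp add: divide_simps) (simp add: algebra_simps)
  finally show ?thesis .
qed

lemma wronskian_diff_smult: "wronskian (P - smult w Q) Q = wronskian P Q"
  by (simp add: wronskian_def pderiv_diff pderiv_smult algebra_simps)

text \<open>This is where the pole at infinity enters: no solution of \<open>P = w Q\<close> escapes
  to infinity.\<close>

lemma diff_smult_lower_degree:
  fixes P Q :: "'a::field poly"
  assumes "degree Q < degree P"
  shows "degree (P - smult w Q) = degree P" "lead_coeff (P - smult w Q) = lead_coeff P"
proof -
  have "degree (- smult w Q) < degree P"
    using assms by (simp del: smult_minus_left)
  from degree_add_eq_left[OF this] show deg: "degree (P - smult w Q) = degree P" by simp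
  show "lead_coeff (P - smult w Q) = lead_coeff P"
    unfolding deg using assms by (simp add: coeff_eq_0)
qed

lemma coprime_poly_common_root:
  fixes P Q :: "'a::field poly"
  assumes "coprime P Q" "poly P z = 0" "poly Q z = 0"
  shows False
proof -
  have "is_unit [:- z, 1:]" using assms by (meson coprime_common_divisor poly_eq_0_iff_dvd)
  then show False by (simp add: is_unit_iff_degree)
qed

text \<open>Were \<open>P' Q = P Q'\<close>, each zero of \<open>P\<close>, not being a zero of
  \<open>Q\<close>, would be a zero of \<open>P'\<close> of at least the same multiplicity, too many
  for the degree of \<open>P'\<close>. The condition on the degree ensures that \<open>P'\<close> is
  not 0.\<close>

lemma wronskian_nonzero:
  fixes P Q :: "'a::alg_closed_field poly"
  assumes "coprime P Q" "Q \<noteq> 0" "of_nat (degree P) \<noteq> (0 :: 'a)"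
  shows "wronskian P Q \<noteq> 0"
proof
  assume "wronskian P Q = 0"
  then have eq: "pderiv P * Q = P * pderiv Q" by (simp add: wronskian_def)
  have d: "degree P > 0" using assms(3) by (cases "degree P") auto
  then have P: "P \<noteq> 0" by auto
  then have "coeff (pderiv P) (degree P - 1) \<noteq> 0"
    using d assms(3) by (simp add: coeff_pderiv)
  then have P': "pderiv P \<noteq> 0" by auto
  then have Q': "pderiv Q \<noteq> 0" using eq assms(2) by auto
  have "proots P + proots (pderiv Q) = proots (pderiv P) + proots Q"
    using eq P P' Q' assms(2) by (simp flip: proots_mult)
  moreover have "proots P \<inter># proots Q = {#}"
    using coprime_poly_common_root[OF assms(1)] P assms(2)
    by (auto simp: disjunct_not_in)
  ultimately have "proots P \<subseteq># proots (pderiv P)"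
  proof (intro mset_subset_eqI)
    fix x
    assume sum: "proots P + proots (pderiv Q) = proots (pderiv P) + proots Q"
      and "proots P \<inter># proots Q = {#}"
    then have "count (proots P) x = 0 \<or> count (proots Q) x = 0"
      by (metis count_eq_zero_iff disjunct_not_in)
    moreover have "count (proots P) x + count (proots (pderiv Q)) x =
        count (proots (pderiv P)) x + count (proots Q) x"
      by (metis count_union sum)
    ultimately show "count (proots P) x \<le> count (proots (pderiv P)) x" by auto
  qed
  then have "degree P \<le> size (proots (pderiv P))"
    using proots_prod_linear_factors(2)[OF P] size_mset_mono by metis
  also have "\<dots> \<le> degree (pderiv P)" by (rule size_proots_le)
  also have "\<dots> \<le> degree P - 1" by (intro degree_le) (simp add: coeff_pderiv coeff_eq_0)
  finally show False using d by simp
qed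

lemma poly_pderiv_multiple_root:
  fixes p :: "'a::field poly"
  assumes "p \<noteq> 0" "count (proots p) x \<ge> 2"
  shows "poly p x = 0" "poly (pderiv p) x = 0"
proof -
  have "[:- x, 1:] ^ 2 dvd p"
    using assms by (metis count_proots dvd_trans le_imp_power_dvd order_1)
  then obtain q where "p = [:- x, 1:] * ([:- x, 1:] * q)"
    unfolding power2_eq_square mult.assoc dvd_def by blast
  then show "poly p x = 0" "poly (pderiv p) x = 0"
    by (simp_all add: pderiv_mult del: mult_pCons_left)
qed

section \<open>Ultrametric geometry\<close>

context nonarch_absolute_value
begin

section \<open>Rules for a non-archimedean absolute value\<close>

lemma absv_zero [simp]: "absv 0 = 0"
  using absv_eq_0_iff by blast

lemma absv_pos_iff [simp]: "0 < absv x \<longleftrightarrow> x \<noteq> 0"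
  using absv_nonneg[of x] absv_eq_0_iff[of x] by (auto simp: less_le)

lemma absv_le_zero_iff [simp]: "absv x \<le> 0 \<longleftrightarrow> x = 0"
  using absv_pos_iff[of x] by linarith

lemma absv_minus_commute: "absv (x - y) = absv (y - x)"
  using absv_uminus[of "x - y"] by simp

lemma absv_diff_ultrametric: "absv (x - z) \<le> max (absv (x - y)) (absv (y - z))"
  using absv_ultrametric[of "x - y" "y - z"] by simp

lemma absv_add_eq_left:
  assumes "absv y < absv x"
  shows "absv (x + y) = absv x"
proof (rule antisym)
  show "absv (x + y) \<le> absv x" using absv_ultrametric[of x y] assms by simp
  show "absv x \<le> absv (x + y)"
    using absv_ultrametric[of "x + y" "- y"] assms by (simp add: absv_uminus)
qed

lemma absv_add_eq_max:
  assumes "absv x \<noteq> absv y"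
  shows "absv (x + y) = max (absv x) (absv y)"
  using absv_add_eq_left[of x y] absv_add_eq_left[of y x] assms
  by (auto simp: add.commute max_def)

lemma absv_diff_eq_max:
  assumes "absv x \<noteq> absv y"
  shows "absv (x - y) = max (absv x) (absv y)"
  using absv_add_eq_max[of x "- y"] assms by (simp add: absv_uminus)

lemma absv_isosceles:
  assumes "absv (x - y) < absv (y - z)"
  shows "absv (x - z) = absv (y - z)"
  using absv_add_eq_left[of "x - y" "y - z"] assms by (simp add: add.commute)

lemma absv_inverse: "absv (inverse x) = inverse (absv x)"
proof (cases "x = 0")
  case False
  then have "absv x * absv (inverse x) = 1"
    by (simp add: absv_mult[symmetric] absv_one)
  then show ?thesis by (simp add: inverse_unique)
qed simp

lemma absv_divide: "absv (x / y) = absv x / absv y"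
  by (simp add: divide_inverse absv_mult absv_inverse)

lemma absv_power: "absv (x ^ n) = absv x ^ n"
  by (induction n) (simp_all add: absv_one absv_mult)

lemma absv_prod: "absv (prod f A) = (\<Prod>x\<in>A. absv (f x))"
  by (induction A rule: infinite_finite_induct) (simp_all add: absv_one absv_mult)

lemma absv_prod_mset: "absv (\<Prod>x\<in>#A. f x) = (\<Prod>x\<in>#A. absv (f x))"
  by (induction A) (simp_all add: absv_one absv_mult)

lemma absv_sum_mset_le:
  assumes "\<And>x. x \<in># A \<Longrightarrow> absv (f x) \<le> C" "0 \<le> C"
  shows "absv (\<Sum>x\<in>#A. f x) \<le> C"
  using assms by (induction A) (auto intro: order_trans[OF absv_ultrametric])

lemma absv_of_nat_le_one: "absv (of_nat n) \<le> 1"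
proof (induction n)
  case (Suc n)
  then show ?case using absv_ultrametric[of 1 "of_nat n"] by (simp add: absv_one)
qed simp

lemma absv_of_int_abs: "absv (of_int n) = absv (of_nat (nat \<bar>n\<bar>))"
  by (cases "n \<ge> 0") (simp_all add: of_nat_nat absv_uminus)

text \<open>Two consecutive integers cannot both have absolute value below 1. Averages over
  \<open>N\<close>-th roots thus lose nothing in the division by \<open>N\<close>.\<close>

lemma exists_exponent_absv_one: "\<exists>N\<ge>m. N > 0 \<and> absv (of_nat N) = 1"
proof (cases "absv (of_nat (Suc m)) = 1")
  case False
  then have "absv (of_nat (Suc m)) < 1"
    using absv_of_nat_le_one[of "Suc m"] by linarith
  then have "absv (1 + of_nat (Suc m)) = 1"
    by (subst absv_add_eq_left) (simp_all add: absv_one)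
  then have "absv (of_nat (Suc (Suc m))) = 1" by simp
  then show ?thesis by (intro exI[of _ "Suc (Suc m)"]) simp
next
  case True
  then show ?thesis by (intro exI[of _ "Suc m"]) auto
qed

end

section \<open>Density of the values, points in general position, products over roots\<close>

locale alg_closed_absv = nonarch_absolute_value absv
  for absv :: "'a::alg_closed_field \<Rightarrow> real"
begin

lemma absv_poly:
  assumes "p \<noteq> 0"
  shows "absv (poly p z) = absv (lead_coeff p) * (\<Prod>x\<in>#proots p. absv (z - x))"
  by (simp add: poly_prod_proots[OF assms, of z] absv_mult absv_prod_mset)

text \<open>Roots \<open>c\<close> of high order of an element of absolute value above 1 satisfy
  \<open>1 < absv c < hi / lo\<close>. The powers of \<open>c\<close>, divided by a large fixed
  power, start at or below \<open>lo\<close> and cannot jump over the interval.\<close>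

lemma absv_dense:
  assumes "0 < lo" "lo < hi"
  shows "\<exists>w. lo < absv w \<and> absv w < hi"
proof -
  obtain b where b: "absv b > 1"
  proof -
    obtain x where x: "x \<noteq> 0" "absv x \<noteq> 1" using absv_nontrivial by blast
    then have "absv x > 1 \<or> absv (inverse x) > 1"
      by (auto simp: absv_inverse one_less_inverse_iff)
    then show thesis using that by blast
  qed
  define q where "q = hi / lo"
  have q: "q > 1" using assms by (simp add: q_def)
  obtain n where n: "absv b < q ^ n" using real_arch_pow[OF q] by blast
  have n0: "n > 0" using n b by (cases n) auto
  obtain c where c: "c ^ n = b" using nth_root_exists[OF n0] by blast
  have cn: "absv c ^ n = absv b" by (simp add: c[symmetric] absv_power)
  have cq: "absv c < q"
  proof (rule ccontr)
    assume "\<not> absv c < q"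
    then have "q ^ n \<le> absv c ^ n" using q by (intro power_mono) auto
    with n cn show False by simp
  qed
  have c1: "absv c > 1"
  proof (rule ccontr)
    assume "\<not> absv c > 1"
    then have "absv c ^ n \<le> 1" by (intro power_le_one) (auto simp: absv_nonneg)
    with b cn show False by simp
  qed
  have c0: "c \<noteq> 0" using c1 absv_zero not_one_less_zero by metis
  obtain j where j: "lo < absv (c ^ j)"
    using real_arch_pow[OF c1, of lo] by (auto simp: absv_power)
  obtain i where i: "1 / lo < absv c ^ i"
    using real_arch_pow[OF c1, of "1 / lo"] by auto
  let ?f = "\<lambda>n. absv (c ^ n / c ^ i)"
  have f0: "?f 0 \<le> lo"
  proof -
    have "0 < absv c ^ i" using c0 by simp
    with i assms show ?thesis by (simp add: absv_divide absv_one absv_power divide_simps mult.commute)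
  qed
  have "lo < ?f (i + j)" using j c0 by (simp add: power_add)
  then obtain m where m: "?f m \<le> lo" "lo < ?f (Suc m)"
    using f0 ex_least_nat_less[of "\<lambda>k. lo < ?f k" "i + j"] by (auto simp: not_less)
  have "?f (Suc m) = absv c * ?f m" by (simp add: absv_divide absv_mult)
  also have "\<dots> \<le> absv c * lo" using m(1) c1 by (intro mult_left_mono) auto
  also have "\<dots> < q * lo" using cq assms by simp
  also have "\<dots> = hi" using assms by (simp add: q_def)
  finally show ?thesis using m(2) by blast
qed

lemma absv_dense_avoiding:
  assumes "finite T" "0 < lo" "lo < hi"
  shows "\<exists>w. lo < absv w \<and> absv w < hi \<and> absv w \<notin> T"
proof -
  define h where "h = Min (insert hi {x\<in>T. lo < x})"
  have "lo < h" "h \<le> hi" and T: "\<And>x. x \<in> T \<Longrightarrow> lo < x \<Longrightarrow> h \<le> x"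
    using assms by (auto simp: h_def)
  from absv_dense[OF assms(2) this(1)] obtain w where "lo < absv w" "absv w < h" by blast
  then show ?thesis using T \<open>h \<le> hi\<close> by force
qed

text \<open>If a product of factors of absolute value at most 1 equals 1, each has absolute value 1;
  so a root of \<open>u \<Prod>(u - c) = 1\<close> is in general position.\<close>

lemma exists_generic_unit:
  assumes "finite C"
  shows "\<exists>u. absv u = 1 \<and> (\<forall>c\<in>C. absv c \<le> 1 \<longrightarrow> absv (u - c) = 1)"
proof -
  \<comment> \<open>Putting 0 into \<open>B\<close> makes \<open>absv u\<close> itself one of the
    factors and the degree of \<open>p\<close> positive.\<close>
  define B where "B = insert 0 {c\<in>C. absv c \<le> 1}"
  have B: "finite B" "0 \<in> B" "\<And>c. c \<in> B \<Longrightarrow> absv c \<le> 1" using assms by (auto simp: B_def)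
  define p where "p = (\<Prod>c\<in>B. [:- c, 1:])"
  have "degree p = card B" by (simp add: p_def degree_prod_eq_sum_degree)
  then have "degree p > 0"
    using B by (auto simp: card_gt_0_iff)
  then have "degree (p - 1) > 0"
    using degree_add_eq_left[of "- 1" p] by simp
  then obtain u where "poly (p - 1) u = 0" using alg_closed_imp_poly_has_root by blast
  then have pr: "(\<Prod>c\<in>B. absv (u - c)) = 1"
    by (simp add: p_def poly_prod absv_prod[symmetric] absv_one)
  have u1: "absv u \<le> 1"
  proof (rule ccontr)
    assume u: "\<not> absv u \<le> 1"
    have "absv (u - c) > 1" if "c \<in> B" for c
      using B(3)[OF that] u absv_diff_eq_max[of u c] by auto
    then have "(\<Prod>c\<in>B. absv (u - c)) > 1" using B by (intro less_1_prod) auto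
    with pr show False by simp
  qed
  have le: "absv (u - c) \<le> 1" if "c \<in> B" for c
    using B(3)[OF that] u1 absv_ultrametric[of u "- c"] by (auto simp: absv_uminus)
  have eq: "absv (u - c) = 1" if c: "c \<in> B" for c
  proof -
    have "1 = absv (u - c) * (\<Prod>c\<in>B - {c}. absv (u - c))"
      using pr B(1) c by (simp add: prod.remove)
    also have "\<dots> \<le> absv (u - c) * 1"
      using le by (intro mult_left_mono prod_le_1) (auto simp: absv_nonneg)
    finally show ?thesis using le[OF c] by simp
  qed
  show ?thesis using eq[OF B(2)] eq by (intro exI[of _ u]) (auto simp: B_def)
qed

text \<open>A unit in general position, rescaled to the disc of radius \<open>absv b\<close> around
  \<open>x\<close>, keeps the full distance \<open>absv b\<close> from the points of
  \<open>C\<close> in that disc. Gauss norms are values at such points.\<close>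

lemma exists_generic_point:
  assumes "finite C" "b \<noteq> 0"
  shows "\<exists>\<xi>. \<forall>c\<in>C. absv (\<xi> - c) = max (absv b) (absv (x - c))"
proof -
  obtain u where u: "absv u = 1" "\<And>c. c \<in> C \<Longrightarrow> absv ((c - x) / b) \<le> 1 \<Longrightarrow> absv (u - (c - x) / b) = 1"
    using exists_generic_unit[of "(\<lambda>c. (c - x) / b) ` C"] assms(1) by auto
  have b: "absv b > 0" using assms by simp
  have "absv (x + b * u - c) = max (absv b) (absv (x - c))" if c: "c \<in> C" for c
  proof (cases "absv (x - c) \<le> absv b")
    case True
    then have "absv ((c - x) / b) \<le> 1" using b by (simp add: absv_divide absv_minus_commute)
    then have "absv (u - (c - x) / b) = 1" using u(2) c by blast
    moreover have "x + b * u - c = b * (u - (c - x) / b)" using assms by (simp add: field_simps)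
    ultimately show ?thesis using True by (simp add: absv_mult)
  next
    case False
    then show ?thesis using absv_add_eq_left[of "b * u" "x - c"] u(1)
      by (simp add: absv_mult algebra_simps)
  qed
  then show ?thesis by blast
qed

text \<open>Both sides are resultants with \<open>A\<close> up to the same factor; exchanging the
  two sets of roots leaves only the values of \<open>G\<close> and \<open>H\<close> at the roots of
  \<open>A\<close>.\<close>

lemma prod_absv_roots_eq:
  assumes "A \<noteq> 0" "G \<noteq> 0" "H \<noteq> 0" "degree G = degree H" "lead_coeff G = lead_coeff H"
    and eq: "\<And>b. poly A b = 0 \<Longrightarrow> absv (poly G b) = absv (poly H b)"
  shows "(\<Prod>z\<in>#proots G. absv (poly A z)) = (\<Prod>z\<in>#proots H. absv (poly A z))"
proof -
  have *: "(\<Prod>z\<in>#proots G. absv (poly A z)) =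
      absv (lead_coeff A) ^ degree G * (\<Prod>b\<in>#proots A. absv (poly G b) / absv (lead_coeff G))"
    if "G \<noteq> 0" for G
  proof -
    have "(\<Prod>z\<in>#proots G. absv (poly A z)) =
        (\<Prod>z\<in>#proots G. absv (lead_coeff A) * (\<Prod>b\<in>#proots A. absv (z - b)))"
      by (simp add: absv_poly[OF assms(1)])
    also have "\<dots> = absv (lead_coeff A) ^ degree G *
        (\<Prod>b\<in>#proots A. \<Prod>z\<in>#proots G. absv (z - b))"
      using proots_prod_linear_factors(2)[OF that]
      by (simp add: prod_mset.distrib prod_mset.swap[of _ "proots A"])
    also have "(\<Prod>b\<in>#proots A. \<Prod>z\<in>#proots G. absv (z - b)) =
        (\<Prod>b\<in>#proots A. absv (poly G b) / absv (lead_coeff G))"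
      using that by (simp add: absv_poly[OF that] absv_minus_commute absv_eq_0_iff)
    finally show ?thesis .
  qed
  have "(\<Prod>b\<in>#proots A. absv (poly G b) / absv (lead_coeff G)) =
      (\<Prod>b\<in>#proots A. absv (poly H b) / absv (lead_coeff H))"
    using assms by (intro arg_cong[of _ _ prod_mset] image_mset_cong) auto
  then show ?thesis using *[of G] *[of H] assms by simp
qed

text \<open>The distances of \<open>z\<close> and \<open>b\<close> to \<open>B\<close> can differ
  only if both are at most \<open>absv (z - b)\<close>. This is the exchange rule for attaching a
  new point \<open>b\<close> to \<open>B\<close>.\<close>

lemma max_min_dist_eq:
  assumes "finite B" "k \<in> B" "\<And>x. x \<in> B \<Longrightarrow> absv (z - k) \<le> absv (z - x)"
  shows "max (absv (z - k)) (absv (z - b)) = max (Min ((\<lambda>x. absv (x - b)) ` B)) (absv (z - b))"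
proof -
  let ?m = "Min ((\<lambda>x. absv (x - b)) ` B)"
  have "?m \<in> (\<lambda>x. absv (x - b)) ` B" using assms by (intro Min_in) auto
  then obtain c where c: "c \<in> B" "?m = absv (c - b)" by auto
  have "?m \<le> absv (k - b)" using assms by auto
  also have "\<dots> \<le> max (absv (z - k)) (absv (z - b))"
    using absv_diff_ultrametric[of k b z] by (simp add: absv_minus_commute)
  finally have 1: "?m \<le> max (absv (z - k)) (absv (z - b))" .
  have "absv (z - k) \<le> absv (z - c)" using assms c by blast
  also have "\<dots> \<le> max ?m (absv (z - b))"
    using absv_diff_ultrametric[of z c b] c by (simp add: absv_minus_commute)
  finally show ?thesis using 1 by simp
qed

text \<open>Attaching the points to \<open>a\<close> one at a time, \<open>\<rho> j\<close> is the distance from \<open>j\<close> to the points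
  already attached. When \<open>z\<close> runs through the roots of a polynomial, the product over \<open>z\<close> of the
  right-hand side is a product of values of that polynomial at generic points.\<close>

lemma prod_dist_except_nearest:
  assumes "finite X" "a \<in> X" "x2 \<in> X" "x2 \<noteq> a"
  shows "\<exists>\<rho>. \<rho> x2 = absv (x2 - a) \<and> (\<forall>j\<in>X - {a}. \<exists>k\<in>X - {j}. \<rho> j = absv (j - k)) \<and>
    (\<forall>z. \<forall>k\<in>X. (\<forall>x\<in>X. absv (z - k) \<le> absv (z - x)) \<longrightarrow>
      (\<Prod>j\<in>X - {k}. absv (z - j)) = (\<Prod>j\<in>X - {a}. max (\<rho> j) (absv (z - j))))"
proof -
  define good where "good \<rho> B \<longleftrightarrow> (\<forall>j\<in>B - {a}. \<exists>k\<in>B - {j}. \<rho> j = absv (j - k)) \<and>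
    (\<forall>z. \<forall>k\<in>B. (\<forall>x\<in>B. absv (z - k) \<le> absv (z - x)) \<longrightarrow>
      (\<Prod>j\<in>B - {k}. absv (z - j)) = (\<Prod>j\<in>B - {a}. max (\<rho> j) (absv (z - j))))"
    for \<rho> B
  have step: "good (\<rho>(b := Min ((\<lambda>x. absv (x - b)) ` B))) (insert b B)"
    if B: "finite B" "a \<in> B" "b \<notin> B" and g: "good \<rho> B" for \<rho> B b
  proof -
    let ?m = "Min ((\<lambda>x. absv (x - b)) ` B)"
    let ?\<rho> = "\<rho>(b := ?m)"
    have ba: "b \<noteq> a" using B by auto
    have "?m \<in> (\<lambda>x. absv (x - b)) ` B" using B by (intro Min_in) auto
    then obtain c where c: "c \<in> B" "?m = absv (b - c)" by (auto simp: absv_minus_commute)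
    have A: "\<exists>k\<in>insert b B - {j}. ?\<rho> j = absv (j - k)" if j: "j \<in> insert b B - {a}" for j
    proof (cases "j = b")
      case True
      then show ?thesis using c B by (intro bexI[of _ c]) auto
    next
      case False
      then obtain k where "k \<in> B - {j}" "\<rho> j = absv (j - k)"
        using g j unfolding good_def by blast
      with False show ?thesis by (intro bexI[of _ k]) auto
    qed
    have rhs: "(\<Prod>j\<in>insert b B - {a}. max (?\<rho> j) (absv (z - j))) =
        max ?m (absv (z - b)) * (\<Prod>j\<in>B - {a}. max (\<rho> j) (absv (z - j)))" for z
    proof -
      have "insert b B - {a} = insert b (B - {a})" using ba by auto
      moreover have "(\<Prod>j\<in>B - {a}. max (?\<rho> j) (absv (z - j))) =
          (\<Prod>j\<in>B - {a}. max (\<rho> j) (absv (z - j)))"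
        using B by (intro prod.cong) auto
      ultimately show ?thesis using B by simp
    qed
    have "(\<Prod>j\<in>insert b B - {k}. absv (z - j)) =
        (\<Prod>j\<in>insert b B - {a}. max (?\<rho> j) (absv (z - j)))"
      if k: "k \<in> insert b B" "\<forall>x\<in>insert b B. absv (z - k) \<le> absv (z - x)" for z k
    \<comment> \<open>If \<open>b\<close> is not the nearest point, both sides gain the factor
      \<open>absv (z - b)\<close>. If it is, the left side regains the distance to the old nearest
      point \<open>l\<close>, which is also the new factor on the right.\<close>
    proof (cases "k = b")
      case False
      then have kB: "k \<in> B" "\<forall>x\<in>B. absv (z - k) \<le> absv (z - x)" using k by auto
      have "insert b B - {k} = insert b (B - {k})" using False by auto
      then have e1: "(\<Prod>j\<in>insert b B - {k}. absv (z - j)) = absv (z - b) * (\<Prod>j\<in>B - {k}. absv (z - j))"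
        using B by simp
      have e2: "max ?m (absv (z - b)) = absv (z - b)"
        using max_min_dist_eq[OF B(1) kB(1), of z b] kB k by auto
      have e3: "(\<Prod>j\<in>B - {k}. absv (z - j)) = (\<Prod>j\<in>B - {a}. max (\<rho> j) (absv (z - j)))"
        using g kB unfolding good_def by blast
      show ?thesis by (simp only: rhs e1 e2 e3)
    next
      case True
      have "Min ((\<lambda>x. absv (z - x)) ` B) \<in> (\<lambda>x. absv (z - x)) ` B" using B by (intro Min_in) auto
      then obtain l where l: "l \<in> B" "Min ((\<lambda>x. absv (z - x)) ` B) = absv (z - l)" by auto
      have lB: "absv (z - l) \<le> absv (z - x)" if "x \<in> B" for x
        using B that by (simp flip: l(2))
      have "insert b B - {k} = B" using True B by auto
      then have e1: "(\<Prod>j\<in>insert b B - {k}. absv (z - j)) = absv (z - l) * (\<Prod>j\<in>B - {l}. absv (z - j))"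
        by (simp only: prod.remove[OF B(1) l(1)])
      have e2: "max ?m (absv (z - b)) = absv (z - l)"
        using max_min_dist_eq[OF B(1) l(1), of z b] lB k True l(1) by auto
      have e3: "(\<Prod>j\<in>B - {l}. absv (z - j)) = (\<Prod>j\<in>B - {a}. max (\<rho> j) (absv (z - j)))"
        using g lB l unfolding good_def by blast
      show ?thesis by (simp only: rhs e1 e2 e3)
    qed
    with A show ?thesis unfolding good_def by blast
  qed
  have "good \<rho> {a}" for \<rho> by (simp add: good_def)
  \<comment> \<open>\<open>x2\<close> is attached first, which fixes \<open>\<rho> x2\<close>; later
    updates leave it unchanged.\<close>
  from step[OF _ _ _ this, of x2] assms
  have base: "good (\<rho>(x2 := absv (x2 - a))) {x2, a}" for \<rho>
    by (simp add: absv_minus_commute)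
  define C where "C = X - {a, x2}"
  have "finite C" "a \<notin> C" "x2 \<notin> C" using assms by (auto simp: C_def)
  then have "\<exists>\<rho>. \<rho> x2 = absv (x2 - a) \<and> good \<rho> ({x2, a} \<union> C)"
  proof (induction C)
    case empty
    show ?case using base by (intro exI[of _ "(\<lambda>_. 0)(x2 := absv (x2 - a))"] conjI) (simp_all only: Un_empty_right fun_upd_same)
  next
    case (insert b C)
    then obtain \<rho> where \<rho>: "\<rho> x2 = absv (x2 - a)" "good \<rho> ({x2, a} \<union> C)" by auto
    let ?\<rho> = "\<rho>(b := Min ((\<lambda>x. absv (x - b)) ` ({x2, a} \<union> C)))"
    have "good ?\<rho> (insert b ({x2, a} \<union> C))"
      by (rule step[OF _ _ _ \<rho>(2)]) (use insert in auto)
    moreover have "insert b ({x2, a} \<union> C) = {x2, a} \<union> insert b C" by auto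
    moreover have "?\<rho> x2 = absv (x2 - a)" using insert \<rho>(1) by auto
    ultimately show ?case by metis
  qed
  moreover have "{x2, a} \<union> C = X" using assms by (auto simp: C_def)
  ultimately show ?thesis unfolding good_def by auto
qed

text \<open>The supremum of \<open>absv p\<close> on the disc of radius \<open>\<rho>\<close> around
  \<open>c\<close>, expressed through the roots. For \<open>\<rho> = 0\<close> it is the value at
  \<open>c\<close>.\<close>

definition gauss_norm :: "'a poly \<Rightarrow> 'a \<Rightarrow> real \<Rightarrow> real" where
  "gauss_norm p c \<rho> = absv (lead_coeff p) * (\<Prod>x\<in>#proots p. max \<rho> (absv (c - x)))"

lemma absv_poly_eq_gauss_norm:
  assumes "p \<noteq> 0" "\<And>x. poly p x = 0 \<Longrightarrow> absv (z - x) = max \<rho> (absv (c - x))"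
  shows "absv (poly p z) = gauss_norm p c \<rho>"
  unfolding absv_poly[OF assms(1)] gauss_norm_def using assms
  by (intro arg_cong2[of _ _ _ _ times] refl arg_cong[of _ _ prod_mset] image_mset_cong) auto

lemma gauss_norm_pos:
  assumes "p \<noteq> 0" "\<rho> > 0"
  shows "gauss_norm p c \<rho> > 0"
proof -
  have "(\<Prod>x\<in>#A. max \<rho> (absv (c - x))) > 0" for A
    using assms by (induction A) (auto simp: less_max_iff_disj)
  then show ?thesis using assms by (simp add: gauss_norm_def)
qed

text \<open>Every point of an ultrametric disc is a centre of it.\<close>

lemma gauss_norm_center:
  assumes "absv (c - c') \<le> \<rho>"
  shows "gauss_norm p c \<rho> = gauss_norm p c' \<rho>"
proof -
  have "max \<rho> (absv (c - x)) = max \<rho> (absv (c' - x))" for x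
    using absv_diff_ultrametric[of c x c'] absv_diff_ultrametric[of c' x c] assms
    by (auto simp: absv_minus_commute)
  then show ?thesis by (simp add: gauss_norm_def)
qed

text \<open>At a point in general position for \<open>P\<close>, \<open>Q\<close> and
  \<open>P - w Q\<close> at once, the Gauss norms are actual values, and a difference of elements of
  unequal size is as large as the larger one.\<close>

lemma gauss_norm_diff_smult_ge:
  assumes "P \<noteq> 0" "Q \<noteq> 0" "P - smult w Q \<noteq> 0" "b \<noteq> 0"
    and ne: "gauss_norm P c (absv b) \<noteq> absv w * gauss_norm Q c (absv b)"
  shows "gauss_norm P c (absv b) \<le> gauss_norm (P - smult w Q) c (absv b)"
    "absv w * gauss_norm Q c (absv b) \<le> gauss_norm (P - smult w Q) c (absv b)"
proof -
  let ?G = "P - smult w Q"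
  have "finite ({x. poly P x = 0} \<union> {x. poly Q x = 0} \<union> {x. poly ?G x = 0})"
    using assms poly_roots_finite by blast
  from exists_generic_point[OF this assms(4), of c]
  obtain \<xi> where \<xi>: "\<And>x. poly P x = 0 \<or> poly Q x = 0 \<or> poly ?G x = 0 \<Longrightarrow>
      absv (\<xi> - x) = max (absv b) (absv (c - x))" by auto
  have "absv (poly P \<xi>) = gauss_norm P c (absv b)" "absv (poly Q \<xi>) = gauss_norm Q c (absv b)"
    "absv (poly ?G \<xi>) = gauss_norm ?G c (absv b)"
    using assms \<xi> by (intro absv_poly_eq_gauss_norm; auto)+
  moreover have "poly ?G \<xi> = poly P \<xi> - w * poly Q \<xi>" by simp
  ultimately have "gauss_norm ?G c (absv b) =
      max (gauss_norm P c (absv b)) (absv w * gauss_norm Q c (absv b))"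
    using absv_diff_eq_max[of "poly P \<xi>" "w * poly Q \<xi>"] ne by (simp add: absv_mult)
  then show "gauss_norm P c (absv b) \<le> gauss_norm ?G c (absv b)"
    "absv w * gauss_norm Q c (absv b) \<le> gauss_norm ?G c (absv b)" by simp_all
qed

text \<open>Without zeros strictly between the two radii, the Gauss norm varies as a power of the
  radius, the exponent being the number of zeros inside.\<close>

lemma gauss_norm_shrink:
  assumes "\<rho> < \<Delta>" "\<And>x. poly p x = 0 \<Longrightarrow> absv (c - x) < \<Delta> \<Longrightarrow> absv (c - x) \<le> \<rho>" "p \<noteq> 0"
  shows "gauss_norm p c \<rho> * \<Delta> ^ size {#x \<in># proots p. absv (c - x) < \<Delta>#} =
    gauss_norm p c \<Delta> * \<rho> ^ size {#x \<in># proots p. absv (c - x) < \<Delta>#}"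
proof -
  have *: "(\<Prod>x\<in>#A. max \<rho> (absv (c - x))) * \<Delta> ^ size {#x \<in># A. absv (c - x) < \<Delta>#} =
      (\<Prod>x\<in>#A. max \<Delta> (absv (c - x))) * \<rho> ^ size {#x \<in># A. absv (c - x) < \<Delta>#}"
    if "\<And>x. x \<in># A \<Longrightarrow> absv (c - x) < \<Delta> \<Longrightarrow> absv (c - x) \<le> \<rho>" for A
    using that
  proof (induction A)
    case (add x A)
    then have IH: "(\<Prod>x\<in>#A. max \<rho> (absv (c - x))) * \<Delta> ^ size {#x \<in># A. absv (c - x) < \<Delta>#} =
      (\<Prod>x\<in>#A. max \<Delta> (absv (c - x))) * \<rho> ^ size {#x \<in># A. absv (c - x) < \<Delta>#}" by simp
    show ?case
    proof (cases "absv (c - x) < \<Delta>")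
      case True
      then have "max \<rho> (absv (c - x)) = \<rho>" "max \<Delta> (absv (c - x)) = \<Delta>"
        using add.prems[of x] by auto
      then show ?thesis using True IH by (simp add: mult_ac)
    next
      case False
      then have "max \<rho> (absv (c - x)) = absv (c - x)" "max \<Delta> (absv (c - x)) = absv (c - x)"
        using assms(1) by auto
      then show ?thesis using False IH by (simp add: mult_ac)
    qed
  qed simp
  show ?thesis using *[of "proots p"] assms(2,3) by (simp add: gauss_norm_def mult.assoc)
qed

section \<open>Critical points\<close>

text \<open>Over values \<open>w\<close> close to \<open>\<phi>(b)\<close>, the sum of the \<open>1 / (b - z)\<close> over the solutions \<open>z\<close> of
  \<open>\<phi>(z) = w\<close> does not depend on \<open>w\<close>, while the product of the \<open>b - z\<close> tends to 0. So at least two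
  solutions approach \<open>b\<close>, and they are distinct because \<open>\<phi>'\<close> has isolated zeros.\<close>

lemma critical_point_wronskian_root:
  assumes W: "wronskian (rat_num \<phi>) (rat_den \<phi>) \<noteq> 0"
    and deg: "degree (rat_den \<phi>) < degree (rat_num \<phi>)"
    and b: "poly (wronskian (rat_num \<phi>) (rat_den \<phi>)) b = 0" "poly (rat_den \<phi>) b \<noteq> 0"
  shows "critical_point absv \<phi> (Fin b)"
  unfolding critical_point_def locally_injective_at_def
proof (intro notI, elim exE conjE)
  fix e :: real
  assume e: "e > 0" and inj: "inj_on (rat_map \<phi>) (proj_ball absv (Fin b) e)"
  define P Q v where "P = rat_num \<phi>" and "Q = rat_den \<phi>" and "v = poly P b / poly Q b"
  let ?W = "wronskian P Q"
  \<comment> \<open>On the ball of radius \<open>e'\<close> the map is injective and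
    \<open>b\<close> is the only zero of the Wronskian.\<close>
  define e' where "e' = Min (insert e ((\<lambda>z. absv (z - b)) ` ({z. poly ?W z = 0} - {b})))"
  have fin: "finite {z. poly ?W z = 0}" using W poly_roots_finite P_def Q_def by blast
  then have e'0: "e' > 0" using e by (auto simp: e'_def)
  have e'e: "e' \<le> e" using fin by (auto simp: e'_def)
  have e'W: "poly ?W z \<noteq> 0" if "z \<noteq> b" "absv (z - b) < e'" for z
  proof
    assume "poly ?W z = 0"
    then have "e' \<le> absv (z - b)" unfolding e'_def using fin that by (intro Min_le) auto
    with that show False by simp
  qed
  define \<kappa> where "\<kappa> = poly (pderiv Q) b / poly Q b"
  define M where "M = max (absv \<kappa>) (1 / e')"
  have M0: "M > 0" using e'0 by (auto simp: M_def less_max_iff_disj)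
  have "1 / e' \<le> M" by (simp add: M_def)
  then have Me': "1 / M \<le> e'" using e'0 M0 by (simp add: divide_simps mult.commute)
  let ?d = "degree P"
  have P0: "P \<noteq> 0" using deg by (auto simp: P_def)
  have Qb: "absv (poly Q b) > 0" using b by (simp add: Q_def)
  \<comment> \<open>Chosen so that \<open>absv x < h\<close> makes the product of the distances from
    \<open>b\<close> to the fibre smaller than \<open>(1 / M) ^ degree P\<close>.\<close>
  define h where "h = absv (lead_coeff P) * (1 / M) ^ ?d / absv (poly Q b)"
  have h: "h > 0" unfolding h_def using P0 M0 Qb by (intro divide_pos_pos mult_pos_pos) auto
  obtain x where x: "absv x < h" "x \<noteq> 0"
    using absv_dense[of "h / 2" h] h by force
  define w where "w = v + x"
  define G where "G = P - smult w Q"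
  have G: "degree G = ?d" "lead_coeff G = lead_coeff P"
    using diff_smult_lower_degree[of Q P w] deg by (simp_all add: G_def P_def Q_def)
  have G0: "G \<noteq> 0" using P0 G(2) by (metis leading_coeff_0_iff)
  have Gb: "poly G b = - x * poly Q b"
    using b by (simp add: G_def w_def v_def Q_def field_simps)
  then have Gb0: "poly G b \<noteq> 0" using x b by (simp add: Q_def)
  \<comment> \<open>As the Wronskian vanishes at \<open>b\<close>, both \<open>G\<close> and
    \<open>G'\<close> are multiples of \<open>x\<close> there, so their quotient does not depend on
    \<open>w\<close>.\<close>
  have "poly (pderiv P) b = v * poly (pderiv Q) b"
    using b by (simp add: v_def poly_wronskian P_def Q_def field_simps)
  then have "poly (pderiv G) b = - x * poly (pderiv Q) b"
    by (simp add: G_def w_def pderiv_diff pderiv_smult algebra_simps)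
  then have \<kappa>: "(\<Sum>z\<in>#proots G. 1 / (b - z)) = \<kappa>"
    using log_pderiv_proots[OF Gb0] Gb Gb0 by (simp add: \<kappa>_def)
  have map: "rat_map \<phi> (Fin z) = Fin w" if "z \<in># proots G" for z
  proof -
    have z: "poly P z = w * poly Q z" using that G0 by (simp add: G_def)
    have "poly Q z \<noteq> 0"
      using coprime_poly_common_root[OF rat_coprime[of \<phi>]] z unfolding P_def Q_def by auto
    then show ?thesis using z by (simp add: rat_eval_def P_def Q_def)
  qed
  \<comment> \<open>A fibre point \<open>z\<close> within \<open>1 / M\<close> of \<open>b\<close>
    would be the only one in the \<open>e'\<close>-ball, so \<open>1 / (b - z)\<close> would be
    \<open>\<kappa>\<close> minus terms of size at most \<open>1 / e'\<close>.\<close>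
  have far: "1 / M \<le> absv (b - z)" if z: "z \<in># proots G" for z
  proof (rule ccontr)
    assume "\<not> 1 / M \<le> absv (b - z)"
    then have zM: "absv (b - z) < 1 / M" by simp
    then have ze': "absv (z - b) < e'" using Me' by (simp add: absv_minus_commute)
    have zb: "z \<noteq> b" using Gb0 z G0 by auto
    have Wz: "poly ?W z \<noteq> 0" using e'W zb ze' by simp
    obtain R where R: "proots G = add_mset z R" using multi_member_split[OF z] by blast
    have "e' \<le> absv (b - y)" if y: "y \<in># R" for y
    proof (rule ccontr)
      assume "\<not> e' \<le> absv (b - y)"
      then have "y = z"
        using inj_onD[OF inj, of "Fin y" "Fin z"] map[of y] map[OF z] y R ze' e'e
        by (auto simp: absv_minus_commute)
      \<comment> \<open>Injectivity excludes distinct fibre points only; a repeated one would be a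
        zero of the Wronskian.\<close>
      with y R have "count (proots G) z \<ge> 2" by (simp add: Suc_le_eq)
      from poly_pderiv_multiple_root[OF G0 this] have "poly (wronskian G Q) z = 0"
        by (simp add: poly_wronskian)
      with Wz show False by (simp add: G_def wronskian_diff_smult)
    qed
    then have "absv (\<Sum>y\<in>#R. 1 / (b - y)) \<le> 1 / e'"
      using e'0 by (intro absv_sum_mset_le) (auto simp: absv_divide absv_one frac_le)
    moreover have "1 / (b - z) = \<kappa> - (\<Sum>y\<in>#R. 1 / (b - y))"
      using \<kappa> R by (simp add: algebra_simps)
    ultimately have "absv (1 / (b - z)) \<le> M"
      using absv_ultrametric[of \<kappa> "- (\<Sum>y\<in>#R. 1 / (b - y))"] by (auto simp: M_def absv_uminus)
    moreover have "0 < absv (b - z)" using zb by simp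
    ultimately show False using zM M0 by (simp add: absv_divide absv_one field_simps)
  qed
  have "absv (lead_coeff P) * (1 / M) ^ ?d \<le> absv (lead_coeff P) * (\<Prod>z\<in>#proots G. absv (b - z))"
  proof (intro mult_left_mono absv_nonneg)
    have "(1 / M) ^ ?d = (\<Prod>z\<in>#proots G. 1 / M)"
      using proots_prod_linear_factors(2)[OF G0] G by simp
    also have "\<dots> \<le> (\<Prod>z\<in>#proots G. absv (b - z))"
      using far M0 by (intro prod_mset_mono_nonneg) auto
    finally show "(1 / M) ^ ?d \<le> (\<Prod>z\<in>#proots G. absv (b - z))" .
  qed
  also have "\<dots> = absv x * absv (poly Q b)"
    using absv_poly[OF G0, of b] G Gb by (simp add: absv_mult absv_uminus)
  also have "\<dots> < h * absv (poly Q b)" using x Qb by (intro mult_strict_right_mono) auto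
  also have "\<dots> = absv (lead_coeff P) * (1 / M) ^ ?d" using b by (simp add: h_def Q_def absv_eq_0_iff)
  finally show False by simp
qed

section \<open>The lower bound for the derivative\<close>

lemma absv_poly_sphere:
  assumes "p \<noteq> 0" "\<And>c. poly p c = 0 \<Longrightarrow> absv (c0 - c) \<noteq> absv v"
  shows "absv (poly p (c0 + v)) = gauss_norm p c0 (absv v)"
proof (rule absv_poly_eq_gauss_norm[OF assms(1)])
  fix c assume "poly p c = 0"
  then show "absv (c0 + v - c) = max (absv v) (absv (c0 - c))"
    using absv_add_eq_max[of v "c0 - c"] assms(2)[of c] by (simp add: algebra_simps)
qed

text \<open>The mean of \<open>v / (v - c)\<close> over the roots of \<open>v\<^sup>N = u\<^sup>N\<close> tends to 1 or 0 as \<open>N\<close> grows,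
  according to whether \<open>c\<close> lies inside or outside the sphere. So the mean of \<open>v \<phi>' / \<phi>\<close> tends to
  the number of zeros minus the number of poles inside, and \<open>N\<close> can be taken with \<open>|N| = 1\<close>.\<close>

lemma absv_wronskian_ge:
  fixes P Q :: "'a poly" and c0 u :: 'a
  defines "cnt \<equiv> \<lambda>p. size {#c \<in># proots p. absv (c0 - c) < absv u#}"
  assumes PQ: "P \<noteq> 0" "Q \<noteq> 0" and u: "u \<noteq> 0"
    and sphere: "\<And>c. poly (P * Q) c = 0 \<Longrightarrow> absv (c0 - c) \<noteq> absv u"
    and crit: "\<And>b. poly (wronskian P Q) b = 0 \<Longrightarrow> absv u \<le> absv (c0 + u - b)"
    and n0: "(of_int (int (cnt P) - int (cnt Q)) :: 'a) \<noteq> 0"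
  shows "absv (of_int (int (cnt P) - int (cnt Q))) *
      (absv (poly P (c0 + u)) * absv (poly Q (c0 + u))) \<le> absv u * absv (poly (wronskian P Q) (c0 + u))"
proof -
  let ?W = "wronskian P Q" and ?z = "c0 + u"
  define n where "n = int (cnt P) - int (cnt Q)"
  define D where "D = absv u"
  have D: "D > 0" using u by (simp add: D_def)
  have W: "?W \<noteq> 0" using crit[of "c0 + u"] u by auto
  \<comment> \<open>This is \<open>v \<phi>' / \<phi>\<close> at \<open>c0 + v\<close> for
    \<open>\<phi> = P / Q\<close>.\<close>
  define g where "g v = (\<Sum>x\<in>#proots P. v / (v - (x - c0))) - (\<Sum>y\<in>#proots Q. v / (v - (y - c0)))" for v
  define C where "C = D * absv (poly ?W ?z) / (absv (poly P ?z) * absv (poly Q ?z))"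
  have nz: "poly P (c0 + v) \<noteq> 0" "poly Q (c0 + v) \<noteq> 0" if "absv v = D" for v
    using sphere[of "c0 + v"] that by (auto simp: D_def absv_uminus)
  have C0: "C \<ge> 0" using D by (simp add: C_def absv_nonneg)
  have gv: "g v = v * (poly ?W (c0 + v) / (poly P (c0 + v) * poly Q (c0 + v)))" if v: "absv v = D" for v
  proof -
    have "(\<Sum>x\<in>#proots p. v / (v - (x - c0))) = v * (\<Sum>x\<in>#proots p. 1 / (c0 + v - x))" for p
      by (simp add: sum_mset_distrib_left algebra_simps)
    then have "g v = v * (poly (pderiv P) (c0 + v) / poly P (c0 + v) - poly (pderiv Q) (c0 + v) / poly Q (c0 + v))"
      using nz[OF v] by (simp add: g_def log_pderiv_proots right_diff_distrib)
    with nz[OF v] show ?thesis by (simp add: poly_wronskian divide_simps)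
  qed
  \<comment> \<open>\<open>P\<close> and \<open>Q\<close> have constant absolute value on the
    sphere, and by \<open>crit\<close> the point \<open>c0 + u\<close> is as far from each zero of
    the Wronskian as the sphere allows. So \<open>absv (g v)\<close> is largest at
    \<open>v = u\<close>.\<close>
  have g_le: "absv (g v) \<le> C" if v: "absv v = D" for v
  proof -
    have "absv (poly P (c0 + v)) = absv (poly P ?z)" "absv (poly Q (c0 + v)) = absv (poly Q ?z)"
      using absv_poly_sphere[OF PQ(1), of c0 v] absv_poly_sphere[OF PQ(1), of c0 u]
        absv_poly_sphere[OF PQ(2), of c0 v] absv_poly_sphere[OF PQ(2), of c0 u] sphere v
      by (auto simp: D_def)
    moreover have "absv (poly ?W (c0 + v)) \<le> absv (poly ?W ?z)"
    proof -
      have "absv (c0 + v - b) \<le> absv (?z - b)" if "b \<in># proots ?W" for b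
      proof (cases "absv (c0 - b) = D")
        case True
        then have "absv (c0 + v - b) \<le> D"
          using absv_ultrametric[of v "c0 - b"] v by (simp add: algebra_simps)
        also have "D \<le> absv (?z - b)" using crit that W by (simp add: D_def)
        finally show ?thesis .
      next
        case False
        then show ?thesis
          using absv_add_eq_max[of v "c0 - b"] absv_add_eq_max[of u "c0 - b"] v
          by (simp add: algebra_simps D_def)
      qed
      then show ?thesis unfolding absv_poly[OF W]
        by (intro mult_left_mono prod_mset_mono_nonneg) (auto simp: absv_nonneg)
    qed
    ultimately show ?thesis
      using D v by (simp add: gv C_def absv_mult absv_divide divide_right_mono mult_left_mono absv_nonneg)
  qed
  define h where "h c = (if absv (c0 - c) < D then absv (c0 - c) / D else D / absv (c0 - c))" for c
  \<comment> \<open>The worst ratio of radii governs the convergence of the means; the inserted 0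
    covers an empty set of zeros and poles.\<close>
  define \<theta> where "\<theta> = Max (insert 0 (h ` set_mset (proots P + proots Q)))"
  have \<theta>0: "\<theta> \<ge> 0" unfolding \<theta>_def by (intro Max_ge) auto
  have "h c < 1" if c: "c \<in># proots P + proots Q" for c
  proof -
    have "absv (c0 - c) \<noteq> D" using sphere[of c] c PQ by (auto simp: D_def)
    then show ?thesis using D by (auto simp: h_def divide_less_eq_1)
  qed
  then have \<theta>1: "\<theta> < 1" unfolding \<theta>_def by (subst Max_less_iff) auto
  have h\<theta>: "h c \<le> \<theta>" if "c \<in># proots P + proots Q" for c
    unfolding \<theta>_def using that by (intro Max_ge) auto
  have \<theta>in: "absv (c0 - c) / D \<le> \<theta>" if "c \<in># proots P + proots Q" "absv (c0 - c) < D" for c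
    using h\<theta>[OF that(1)] that(2) by (simp add: h_def)
  have \<theta>out: "D / absv (c0 - c) \<le> \<theta>" if "c \<in># proots P + proots Q" "\<not> absv (c0 - c) < D" for c
    using h\<theta>[OF that(1)] that(2) by (simp add: h_def)
  have npos: "absv (of_int n) > 0" using n0 by (simp add: n_def)
  obtain m where m: "\<theta> ^ m < absv (of_int n)" using real_arch_pow_inv[OF npos \<theta>1] by blast
  obtain N where N: "N \<ge> m" "N > 0" "absv (of_nat N) = 1" using exists_exponent_absv_one by blast
  have \<theta>N: "\<theta> ^ N < absv (of_int n)"
    using power_decreasing[of m N \<theta>] N \<theta>0 \<theta>1 m by simp
  let ?Z = "proots (monom 1 N - [:u ^ N:])"
  have pZ: "monom 1 N - [:u ^ N:] \<noteq> 0"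
    using degree_monom_diff_const[OF N(2), of "u ^ N"] N by auto
  have Zabs: "absv v = D" if "v \<in># ?Z" for v
  proof -
    have "v ^ N = u ^ N" using that pZ by (simp add: poly_monom)
    then have "absv v ^ N = absv u ^ N" by (metis absv_power)
    then show ?thesis using N absv_nonneg by (metis D_def power_eq_imp_eq_base)
  qed
  \<comment> \<open>The deviation of the mean of \<open>v / (v - (c - c0))\<close> from its limit 1
    or 0.\<close>
  define e where "e c = u ^ N / (u ^ N - (c - c0) ^ N) - (if absv (c0 - c) < D then 1 else 0)" for c
  have pow_ne: "(c - c0) ^ N \<noteq> u ^ N" if "c \<in># proots P + proots Q" for c
  proof
    assume "(c - c0) ^ N = u ^ N"
    then have "absv (c - c0) ^ N = absv u ^ N" by (metis absv_power)
    then have "absv (c - c0) = absv u" using N absv_nonneg by (metis power_eq_imp_eq_base)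
    then show False using sphere[of c] that PQ by (auto simp: absv_minus_commute)
  qed
  have e_le: "absv (e c) \<le> \<theta> ^ N" if c: "c \<in># proots P + proots Q" for c
  proof (cases "absv (c0 - c) < D")
    case True
    then have lt: "absv ((c - c0) ^ N) < absv (u ^ N)"
      unfolding absv_power using N
      by (intro power_strict_mono) (auto simp: absv_nonneg D_def absv_minus_commute)
    have "e c = (c - c0) ^ N / (u ^ N - (c - c0) ^ N)"
      using True pow_ne[OF c] by (simp add: e_def divide_simps)
    moreover have "absv (u ^ N - (c - c0) ^ N) = D ^ N"
      using absv_diff_eq_max[of "u ^ N" "(c - c0) ^ N"] lt by (simp add: D_def absv_power)
    ultimately have "absv (e c) = (absv (c0 - c) / D) ^ N"
      by (simp add: absv_divide absv_power power_divide absv_minus_commute)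
    also have "\<dots> \<le> \<theta> ^ N" using \<theta>in[OF c True] D by (intro power_mono) (auto simp: absv_nonneg)
    finally show ?thesis .
  next
    case False
    then have "D < absv (c - c0)" using sphere[of c] c PQ by (auto simp: D_def absv_minus_commute)
    then have lt: "absv (u ^ N) < absv ((c - c0) ^ N)"
      unfolding absv_power using N by (intro power_strict_mono) (auto simp: absv_nonneg D_def)
    have "absv (u ^ N - (c - c0) ^ N) = absv (c0 - c) ^ N"
      using absv_diff_eq_max[of "u ^ N" "(c - c0) ^ N"] lt by (simp add: absv_power absv_minus_commute)
    then have "absv (e c) = (D / absv (c0 - c)) ^ N"
      using False by (simp add: e_def absv_divide absv_power power_divide D_def)
    also have "\<dots> \<le> \<theta> ^ N" using \<theta>out[OF c False] D by (intro power_mono) (auto simp: absv_nonneg)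
    finally show ?thesis .
  qed
  have swap: "(\<Sum>v\<in>#?Z. \<Sum>c\<in>#proots p. v / (v - (c - c0))) =
      of_nat N * (of_nat (cnt p) + (\<Sum>c\<in>#proots p. e c))"
    if p: "proots p \<subseteq># proots P + proots Q" for p
  proof -
    have "(\<Sum>v\<in>#?Z. \<Sum>c\<in>#proots p. v / (v - (c - c0))) = (\<Sum>c\<in>#proots p. \<Sum>v\<in>#?Z. v / (v - (c - c0)))"
      by (rule sum_mset.swap)
    also have "\<dots> = (\<Sum>c\<in>#proots p. of_nat N * ((if absv (c0 - c) < D then 1 else 0) + e c))"
    proof (intro arg_cong[of _ _ sum_mset] image_mset_cong)
      fix c assume "c \<in># proots p"
      then have "(c - c0) ^ N \<noteq> u ^ N" using pow_ne mset_subset_eqD[OF p] by blast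
      from sum_roots_of_power[OF N(2) this]
      show "(\<Sum>v\<in>#?Z. v / (v - (c - c0))) =
          of_nat N * ((if absv (c0 - c) < D then 1 else 0) + e c)"
        by (simp add: e_def)
    qed
    also have "\<dots> = of_nat N * ((\<Sum>c\<in>#proots p. if absv (c0 - c) < D then 1 else 0) + (\<Sum>c\<in>#proots p. e c))"
      by (simp add: sum_mset_distrib_left[symmetric] sum_mset.distrib)
    also have "(\<Sum>c\<in>#A. if absv (c0 - c) < D then 1 else 0) =
        of_nat (size {#c \<in># A. absv (c0 - c) < D#})" for A
      by (induction A) auto
    finally show ?thesis by (simp add: cnt_def D_def)
  qed
  \<comment> \<open>The total deviation is smaller than \<open>absv (of_int n)\<close>, so
    \<open>of_int n + E\<close>, which \<open>C\<close> bounds, has the same absolute value as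
    \<open>of_int n\<close>.\<close>
  define E where "E = (\<Sum>c\<in>#proots P. e c) - (\<Sum>c\<in>#proots Q. e c)"
  have "(\<Sum>v\<in>#?Z. g v) = of_nat N * (of_int n + E)"
    using swap[of P] swap[of Q] by (simp add: g_def sum_mset_diff_fun n_def E_def algebra_simps)
  moreover have "absv (\<Sum>v\<in>#?Z. g v) \<le> C" by (intro absv_sum_mset_le g_le Zabs C0)
  ultimately have nE: "absv (of_int n + E) \<le> C" using N by (simp add: absv_mult)
  have "absv (\<Sum>c\<in>#proots P. e c) \<le> \<theta> ^ N" "absv (\<Sum>c\<in>#proots Q. e c) \<le> \<theta> ^ N"
    using e_le \<theta>0 by (intro absv_sum_mset_le; simp)+
  then have "absv E < absv (of_int n)"
    using \<theta>N absv_ultrametric[of "\<Sum>c\<in>#proots P. e c" "- (\<Sum>c\<in>#proots Q. e c)"]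
    by (simp add: E_def absv_uminus)
  then have "absv (of_int n) \<le> C" using nE absv_add_eq_left by metis
  moreover have "absv (poly P ?z) * absv (poly Q ?z) > 0" using nz[of u] by (simp add: D_def)
  ultimately show ?thesis by (simp add: C_def n_def D_def pos_le_divide_eq)
qed

text \<open>The choice of \<open>t = |\<phi>(z)|\<close> away from the finitely many values taken at branch points makes
  \<open>|\<phi>|\<close> near the sphere around \<open>c0\<close> through \<open>z\<close> a strictly monotone function of the radius.\<close>

lemma absv_wronskian_ge_min_dist:
  assumes PQ: "coprime P Q" "P \<noteq> 0" "Q \<noteq> 0"
    and deg: "degree P \<le> d" "degree Q \<le> d"
    and \<mu>: "\<mu> > 0" "\<And>m. 1 \<le> m \<Longrightarrow> m \<le> d \<Longrightarrow> \<mu> \<le> absv (of_nat m)"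
    and z: "poly P z \<noteq> 0" "poly Q z \<noteq> 0"
    and branch: "\<And>c c'. poly (P * Q) c = 0 \<Longrightarrow> poly (P * Q) c' = 0 \<Longrightarrow>
      gauss_norm P c (absv (c - c')) / gauss_norm Q c (absv (c - c')) \<noteq> absv (poly P z) / absv (poly Q z)"
    and crit: "\<And>b. poly (wronskian P Q) b = 0 \<Longrightarrow> poly Q b \<noteq> 0 \<Longrightarrow>
      absv (poly P b) / absv (poly Q b) \<noteq> absv (poly P z) / absv (poly Q z)"
    and c0: "poly (P * Q) c0 = 0" "\<And>c. poly (P * Q) c = 0 \<Longrightarrow> absv (z - c0) \<le> absv (z - c)"
  shows "\<mu> * (absv (poly P z) * absv (poly Q z)) \<le> absv (z - c0) * absv (poly (wronskian P Q) z)"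
proof -
  define u \<Delta> where "u = z - c0" and "\<Delta> = absv u"
  have zu: "z = c0 + u" by (simp add: u_def)
  have u0: "u \<noteq> 0" using z c0(1) by (auto simp: u_def)
  then have \<Delta>: "\<Delta> > 0" by (simp add: \<Delta>_def)
  \<comment> \<open>As \<open>c0\<close> is nearest to \<open>z\<close>, the point \<open>z\<close>
    is in general position in the disc of radius \<open>\<Delta>\<close> around
    \<open>c0\<close>.\<close>
  have dist: "absv (z - c) = max \<Delta> (absv (c0 - c))" if "poly (P * Q) c = 0" for c
  proof (cases "absv (c0 - c) \<le> \<Delta>")
    case True
    then show ?thesis using c0(2)[OF that] absv_diff_ultrametric[of z c c0]
      by (simp add: \<Delta>_def u_def)
  next
    case False
    then show ?thesis using absv_isosceles[of z c0 c] by (simp add: \<Delta>_def u_def)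
  qed
  have nP: "absv (poly P z) = gauss_norm P c0 \<Delta>" and nQ: "absv (poly Q z) = gauss_norm Q c0 \<Delta>"
    using PQ dist by (intro absv_poly_eq_gauss_norm; simp)+
  have sphere: "absv (c0 - c) \<noteq> absv u" if c: "poly (P * Q) c = 0" for c
    using branch[OF c0(1) c] nP nQ by (auto simp: \<Delta>_def)
  \<comment> \<open>At a zero of the Wronskian closer to \<open>z\<close> than
    \<open>\<Delta>\<close>, \<open>P\<close> and \<open>Q\<close> would have the same absolute
    values as at \<open>z\<close>, against \<open>crit\<close>.\<close>
  have W: "absv u \<le> absv (c0 + u - b)" if b: "poly (wronskian P Q) b = 0" for b
  proof (rule ccontr)
    assume "\<not> absv u \<le> absv (c0 + u - b)"
    then have lt: "absv (b - z) < \<Delta>" by (simp add: zu \<Delta>_def absv_minus_commute)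
    have same: "absv (b - c) = absv (z - c)" if "poly (P * Q) c = 0" for c
      using absv_isosceles[of b z c] lt c0(2)[OF that] by (simp add: \<Delta>_def u_def)
    have "absv (poly P b) = absv (poly P z)" "absv (poly Q b) = absv (poly Q z)"
      unfolding nP nQ using PQ dist same by (intro absv_poly_eq_gauss_norm; simp)+
    moreover from this have "poly Q b \<noteq> 0" using z absv_eq_0_iff by metis
    ultimately show False using crit[OF b] by simp
  qed
  define cnt where "cnt p = size {#x \<in># proots p. absv (c0 - x) < absv u#}" for p
  have cnt_le: "cnt P \<le> d" "cnt Q \<le> d"
    using deg size_proots_le[of P] size_proots_le[of Q]
      size_mset_mono[OF multiset_filter_subset] unfolding cnt_def by (meson order_trans)+
  \<comment> \<open>With equal counts the ratio of the Gauss norms would stay constant down to the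
    largest smaller radius carrying a zero or pole, and so be a branch value. If \<open>c0\<close>
    alone lies inside, coprimality makes exactly one count positive.\<close>
  have cnt_ne: "cnt P \<noteq> cnt Q"
  proof
    assume eq: "cnt P = cnt Q"
    define I where "I = {c. poly (P * Q) c = 0 \<and> absv (c0 - c) < \<Delta>}"
    have "P * Q \<noteq> 0" using PQ by simp
    then have I: "finite I" "c0 \<in> I"
      using poly_roots_finite[of "P * Q"] c0 \<Delta> by (auto simp: I_def intro: finite_subset)
    have "Max ((\<lambda>c. absv (c0 - c)) ` I) \<in> (\<lambda>c. absv (c0 - c)) ` I" using I by (intro Max_in) auto
    then obtain c' where c': "c' \<in> I" "Max ((\<lambda>c. absv (c0 - c)) ` I) = absv (c0 - c')" by auto
    have c'max: "absv (c0 - c) \<le> absv (c0 - c')" if "c \<in> I" for c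
      using I that by (simp flip: c'(2))
    let ?\<rho> = "absv (c0 - c')"
    have \<rho>\<Delta>: "?\<rho> < \<Delta>" using c' by (simp add: I_def)
    have inI: "x \<in> I" if "poly P x = 0 \<or> poly Q x = 0" "absv (c0 - x) < \<Delta>" for x
      using that by (auto simp: I_def)
    have cnt_pos: "cnt p > 0 \<longleftrightarrow> (\<exists>x. poly p x = 0 \<and> absv (c0 - x) < \<Delta>)" if "p \<noteq> 0" for p
      using that by (auto simp: cnt_def \<Delta>_def nonempty_has_size[symmetric] simp flip: set_mset_eq_empty_iff)
    show False
    proof (cases "c' = c0")
      case True
      have "x = c0" if "poly P x = 0 \<or> poly Q x = 0" "absv (c0 - x) < \<Delta>" for x
        using c'max[OF inI[OF that]] True by simp
      then have "cnt P > 0 \<longleftrightarrow> poly P c0 = 0" "cnt Q > 0 \<longleftrightarrow> poly Q c0 = 0"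
        using cnt_pos[OF PQ(2)] cnt_pos[OF PQ(3)] \<Delta> by auto
      with eq c0(1) coprime_poly_common_root[OF PQ(1)] show False by auto
    next
      case False
      then have \<rho>: "?\<rho> > 0" by simp
      have "gauss_norm P c0 ?\<rho> * \<Delta> ^ cnt P = gauss_norm P c0 \<Delta> * ?\<rho> ^ cnt P"
        unfolding cnt_def \<Delta>_def[symmetric]
        by (intro gauss_norm_shrink \<rho>\<Delta> PQ c'max inI) auto
      moreover have "gauss_norm Q c0 ?\<rho> * \<Delta> ^ cnt Q = gauss_norm Q c0 \<Delta> * ?\<rho> ^ cnt Q"
        unfolding cnt_def \<Delta>_def[symmetric]
        by (intro gauss_norm_shrink \<rho>\<Delta> PQ c'max inI) auto
      ultimately have "gauss_norm P c0 ?\<rho> = gauss_norm P c0 \<Delta> * (?\<rho> / \<Delta>) ^ cnt Q"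
        "gauss_norm Q c0 ?\<rho> = gauss_norm Q c0 \<Delta> * (?\<rho> / \<Delta>) ^ cnt Q"
        using eq \<Delta> by (simp_all add: power_divide field_simps)
      then have "gauss_norm P c0 ?\<rho> / gauss_norm Q c0 ?\<rho> = gauss_norm P c0 \<Delta> / gauss_norm Q c0 \<Delta>"
        using False \<Delta> by (simp add: absv_eq_0_iff)
      then show False using branch[OF c0(1), of c'] c'(1) nP nQ by (simp add: I_def)
    qed
  qed
  define m where "m = nat \<bar>int (cnt P) - int (cnt Q)\<bar>"
  have m: "1 \<le> m" "m \<le> d" using cnt_le cnt_ne by (auto simp: m_def)
  have am: "absv (of_int (int (cnt P) - int (cnt Q))) = absv (of_nat m)"
    unfolding m_def by (rule absv_of_int_abs)
  then have "(of_int (int (cnt P) - int (cnt Q)) :: 'a) \<noteq> 0"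
    using \<mu>(1) \<mu>(2)[OF m] by (metis absv_zero not_less)
  from absv_wronskian_ge[OF PQ(2,3) u0 sphere W this[unfolded cnt_def]]
  have "absv (of_nat m) * (absv (poly P z) * absv (poly Q z)) \<le> \<Delta> * absv (poly (wronskian P Q) z)"
    using am by (simp add: zu \<Delta>_def cnt_def)
  moreover have "\<mu> * (absv (poly P z) * absv (poly Q z)) \<le> absv (of_nat m) * (absv (poly P z) * absv (poly Q z))"
    using \<mu>(2)[OF m] by (intro mult_right_mono) (auto simp: absv_nonneg)
  ultimately show ?thesis by (simp add: \<Delta>_def u_def)
qed

section \<open>The critical value\<close>

text \<open>No other zero of \<open>P\<close> is closer to \<open>a\<close> than \<open>x2\<close>,
  so the numerator is \<open>absv (x2 - a)\<close> times the size of \<open>P'(a)\<close>. Either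
  \<open>r = absv (x2 - a)\<close>, or a pole at distance \<open>r\<close> makes the norm of
  \<open>Q\<close> exceed its value at \<open>a\<close> by the factor
  \<open>absv (x2 - a) / r\<close> at least.\<close>

lemma gauss_norm_ratio_nearest_zero:
  assumes PQ: "P \<noteq> 0" "Q \<noteq> 0" and simple: "proots P = mset_set X" "finite X"
    and a: "a \<in> X" "poly Q a \<noteq> 0"
    and x2: "x2 \<in> X - {a}" "\<And>x. x \<in> X - {a} \<Longrightarrow> absv (x2 - a) \<le> absv (x - a)"
    and r: "c \<noteq> a" "poly (P * Q) c = 0" "absv (c - a) = r"
      "\<And>c. c \<noteq> a \<Longrightarrow> poly (P * Q) c = 0 \<Longrightarrow> r \<le> absv (c - a)"
  shows "gauss_norm P x2 (absv (x2 - a)) / gauss_norm Q x2 (absv (x2 - a)) \<le>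
    r * (absv (lead_coeff P) * (\<Prod>x\<in>X - {a}. absv (a - x))) / absv (poly Q a)"
proof -
  let ?r2 = "absv (x2 - a)" and ?L = "absv (lead_coeff P)"
  have r2: "?r2 > 0" using x2 by simp
  have X: "X = {x. poly P x = 0}" using simple PQ set_count_proots[of P] by simp
  have r0: "r > 0" using r by auto
  have rr2: "r \<le> ?r2" using r(4)[of x2] x2 X by auto
  have P2: "gauss_norm P x2 ?r2 = ?r2 * (?L * (\<Prod>x\<in>X - {a}. absv (a - x)))"
  proof -
    have "gauss_norm P x2 ?r2 = gauss_norm P a ?r2" by (rule gauss_norm_center) simp
    also have "\<dots> = ?L * (\<Prod>x\<in>X. max ?r2 (absv (a - x)))"
      by (simp add: gauss_norm_def simple flip: prod_unfold_prod_mset)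
    also have "(\<Prod>x\<in>X. max ?r2 (absv (a - x))) = ?r2 * (\<Prod>x\<in>X - {a}. max ?r2 (absv (a - x)))"
      using simple a by (simp add: prod.remove absv_nonneg max_absorb1)
    also have "(\<Prod>x\<in>X - {a}. max ?r2 (absv (a - x))) = (\<Prod>x\<in>X - {a}. absv (a - x))"
      using x2 by (intro prod.cong) (auto simp: absv_minus_commute max_def)
    finally show ?thesis by simp
  qed
  have Q2: "?r2 * absv (poly Q a) \<le> r * gauss_norm Q x2 ?r2"
  proof -
    have Qa: "absv (poly Q a) = absv (lead_coeff Q) * (\<Prod>y\<in>#proots Q. absv (a - y))"
      by (rule absv_poly[OF PQ(2)])
    have Q2: "gauss_norm Q x2 ?r2 = absv (lead_coeff Q) * (\<Prod>y\<in>#proots Q. max ?r2 (absv (a - y)))"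
      using gauss_norm_center[of x2 a ?r2 Q] by (simp add: gauss_norm_def)
    have mono: "(\<Prod>y\<in>#A. absv (a - y)) \<le> (\<Prod>y\<in>#A. max ?r2 (absv (a - y)))" for A
      by (intro prod_mset_mono_nonneg) (auto simp: absv_nonneg)
    have "?r2 * (\<Prod>y\<in>#proots Q. absv (a - y)) \<le> r * (\<Prod>y\<in>#proots Q. max ?r2 (absv (a - y)))"
    proof (cases "poly P c = 0")
      case True
      then have "?r2 \<le> r" using x2(2)[of c] X r by auto
      with mono[of "proots Q"] show ?thesis using r2 r0
        by (intro mult_mono) (auto intro!: prod_mset_nonneg simp: absv_nonneg)
    next
      case False
      then have "c \<in># proots Q" using r PQ by simp
      from multi_member_split[OF this] obtain A where A: "proots Q = add_mset c A" by blast
      have "r * ?r2 * (\<Prod>y\<in>#A. absv (a - y)) \<le> r * ?r2 * (\<Prod>y\<in>#A. max ?r2 (absv (a - y)))"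
        using mono r0 by (intro mult_left_mono mult_nonneg_nonneg absv_nonneg) auto
      moreover have "absv (a - c) = r" using r(3) by (simp only: absv_minus_commute[of a c])
      moreover have "max ?r2 r = ?r2" using rr2 by (rule max_absorb1)
      ultimately show ?thesis by (simp only: A image_mset_add_mset prod_mset.add_mset) (simp add: mult_ac)
    qed
    then have "absv (lead_coeff Q) * (?r2 * (\<Prod>y\<in>#proots Q. absv (a - y))) \<le>
        absv (lead_coeff Q) * (r * (\<Prod>y\<in>#proots Q. max ?r2 (absv (a - y))))"
      by (rule mult_left_mono[OF _ absv_nonneg])
    then show ?thesis by (simp add: Qa Q2 mult_ac)
  qed
  have "?L * (\<Prod>x\<in>X - {a}. absv (a - x)) \<ge> 0" by (intro mult_nonneg_nonneg prod_nonneg) (auto simp: absv_nonneg)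
  then have "?L * (\<Prod>x\<in>X - {a}. absv (a - x)) * (?r2 * absv (poly Q a)) \<le>
      ?L * (\<Prod>x\<in>X - {a}. absv (a - x)) * (r * gauss_norm Q x2 ?r2)"
    by (rule mult_left_mono[OF Q2])
  moreover have "absv (poly Q a) > 0" "gauss_norm Q x2 ?r2 > 0"
    using a gauss_norm_pos[OF PQ(2) r2] by auto
  ultimately show ?thesis unfolding P2 by (simp add: divide_simps mult_ac)
qed

text \<open>The fibre over \<open>w\<close>, with \<open>absv w\<close> between the bound and all
  critical values, is compared with the fibre \<open>X\<close> over 0; the estimates give
  \<open>t \<le> lo\<close>, against the choice of \<open>w\<close>.\<close>

lemma exists_small_critical_value:
  assumes PQ: "coprime P Q" "Q \<noteq> 0" "degree Q < degree P" "2 \<le> degree P"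
    and \<mu>: "\<mu> > 0" "\<And>m. 1 \<le> m \<Longrightarrow> m \<le> degree P \<Longrightarrow> \<mu> \<le> absv (of_nat m)"
    and a: "poly P a = 0"
    and r: "c \<noteq> a" "poly (P * Q) c = 0" "absv (c - a) = r"
      "\<And>c. c \<noteq> a \<Longrightarrow> poly (P * Q) c = 0 \<Longrightarrow> r \<le> absv (c - a)"
  shows "\<exists>b. poly (wronskian P Q) b = 0 \<and> poly Q b \<noteq> 0 \<and>
    absv (poly P b / poly Q b) \<le> r * absv (poly (wronskian P Q) a / (poly Q a)\<^sup>2) / \<mu> ^ degree P"
proof (rule ccontr)
  let ?W = "wronskian P Q" and ?d = "degree P" and ?L = "absv (lead_coeff P)"
  define lo where "lo = r * absv (poly ?W a / (poly Q a)\<^sup>2) / \<mu> ^ ?d"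
  assume "\<not> (\<exists>b. poly ?W b = 0 \<and> poly Q b \<noteq> 0 \<and>
    absv (poly P b / poly Q b) \<le> r * absv (poly ?W a / (poly Q a)\<^sup>2) / \<mu> ^ ?d)"
  then have big: "lo < absv (poly P b / poly Q b)" if "poly ?W b = 0" "poly Q b \<noteq> 0" for b
    using that by (force simp: lo_def)
  have P0: "P \<noteq> 0" using PQ by auto
  have L0: "?L > 0" using P0 by simp
  have common: False if "poly P z = 0" "poly Q z = 0" for z
    using coprime_poly_common_root[OF PQ(1) that] .
  have r0: "r > 0" using r by auto
  have lo_nonneg: "lo \<ge> 0" using r0 \<mu> by (simp add: lo_def absv_nonneg)
  have Qa: "poly Q a \<noteq> 0" using common a by blast
  define X where "X = {x. poly P x = 0}"
  have finX: "finite X" using P0 poly_roots_finite by (simp add: X_def)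
  \<comment> \<open>A critical zero of \<open>P\<close> would have critical value 0, which
    \<open>big\<close> excludes.\<close>
  have WX: "poly ?W x \<noteq> 0" if "x \<in> X" for x
    using big[of x] common[of x] that lo_nonneg by (auto simp: X_def)
  have lo0: "lo > 0" using r0 \<mu> WX[of a] a Qa by (simp add: lo_def X_def)
  have simple: "proots P = mset_set X"
  proof (rule multiset_eqI)
    fix x
    show "count (proots P) x = count (mset_set X) x"
    proof (cases "x \<in> X")
      case True
      have "\<not> count (proots P) x \<ge> 2"
        using poly_pderiv_multiple_root[OF P0] WX[OF True] by (auto simp: poly_wronskian)
      moreover have "x \<in># proots P" using True P0 by (simp add: X_def)
      then have "count (proots P) x > 0" by simp
      ultimately have "count (proots P) x = 1" by linarith
      then show ?thesis using True finX by simp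
    next
      case False
      then have "x \<notin># proots P" using P0 by (simp add: X_def)
      then show ?thesis using False by (simp add: not_in_iff)
    qed
  qed
  have prodX: "(\<Prod>x\<in>#proots P. f x) = (\<Prod>x\<in>X. f x)" for f :: "'a \<Rightarrow> real"
    by (simp add: simple prod_unfold_prod_mset)
  have cardX: "card X = ?d"
    using proots_prod_linear_factors(2)[OF P0] simple by simp
  have aX: "a \<in> X" using a by (simp add: X_def)
  have derivX: "absv (poly ?W x) = ?L * (\<Prod>j\<in>X - {x}. absv (x - j)) * absv (poly Q x)" if x: "x \<in> X" for x
  proof -
    let ?q = "\<Prod>j\<in>X - {x}. [:- j, 1:]"
    have "P = smult (lead_coeff P) (\<Prod>j\<in>X. [:- j, 1:])"
      using proots_prod_linear_factors(1)[OF P0] by (simp add: simple prod_unfold_prod_mset)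
    also have "(\<Prod>j\<in>X. [:- j, 1:]) = [:- x, 1:] * ?q"
      using finX x by (simp only: prod.remove)
    finally have "poly (pderiv P) x = poly (pderiv (smult (lead_coeff P) ([:- x, 1:] * ?q))) x" by metis
    also have "\<dots> = lead_coeff P * (\<Prod>j\<in>X - {x}. x - j)"
      by (simp add: pderiv_smult pderiv_mult pderiv_pCons poly_prod del: mult_pCons_left)
    finally show ?thesis
      using x by (simp add: poly_wronskian X_def absv_mult absv_prod)
  qed

  \<comment> \<open>Choice of \<open>w\<close> and the fibre \<open>Z\<close> over it\<close>
  define S where "S = {x. poly (P * Q) x = 0}"
  have finS: "finite S" unfolding S_def using P0 PQ by (intro poly_roots_finite) simp
  have XS: "X \<subseteq> S" by (auto simp: X_def S_def)
  define T where "T = (\<lambda>(c, c'). gauss_norm P c (absv (c - c')) / gauss_norm Q c (absv (c - c'))) ` (S \<times> S)"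
  define V where "V = (\<lambda>b. absv (poly P b / poly Q b)) ` {b. poly ?W b = 0 \<and> poly Q b \<noteq> 0}"
  \<comment> \<open>\<open>lo + 1\<close> keeps the minimum meaningful when \<open>V\<close> is
    empty.\<close>
  define hi where "hi = Min (insert (lo + 1) V)"
  have W0: "?W \<noteq> 0" using WX[OF aX] by auto
  have finV: "finite V" unfolding V_def
    using finite_subset[OF _ poly_roots_finite[OF W0]] by auto
  have "lo < hi" using finV big by (auto simp: hi_def V_def)
  moreover have "finite T" using finS by (simp add: T_def)
  ultimately obtain w where w: "lo < absv w" "absv w < hi" "absv w \<notin> T"
    using absv_dense_avoiding[of T lo hi] lo0 by blast
  define t where "t = absv w"
  have t0: "t > 0" unfolding t_def using w(1) lo0 by linarith
  have tV: "t < absv (poly P b / poly Q b)" if "poly ?W b = 0" "poly Q b \<noteq> 0" for b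
  proof -
    have "hi \<le> absv (poly P b / poly Q b)"
      unfolding hi_def using finV that by (intro Min_le) (auto simp: V_def)
    with w show ?thesis by (simp add: t_def)
  qed
  define G where "G = P - smult w Q"
  note degG = diff_smult_lower_degree[OF PQ(3), of w, folded G_def]
  have G0: "G \<noteq> 0" using P0 degG(2) by (metis leading_coeff_0_iff)
  define Z where "Z = proots G"
  have sizeZ: "size Z = ?d" unfolding Z_def using proots_prod_linear_factors(2)[OF G0] degG by simp
  have Zval: "poly P z = w * poly Q z" "poly Q z \<noteq> 0" "poly P z \<noteq> 0"
    "absv (poly P z) = t * absv (poly Q z)" if "z \<in># Z" for z
  proof -
    show 1: "poly P z = w * poly Q z" using that G0 by (simp add: Z_def G_def)
    then show "poly Q z \<noteq> 0" using common[of z] by auto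
    then show "poly P z \<noteq> 0" using 1 t0 by (auto simp: t_def)
    show "absv (poly P z) = t * absv (poly Q z)" by (simp add: 1 absv_mult t_def)
  qed

  \<comment> \<open>Distances from the fibre to the zeros of \<open>P\<close>, and products over the
    fibre\<close>
  define \<delta> where "\<delta> z = Min ((\<lambda>x. absv (z - x)) ` X)" for z
  have near: "\<exists>k\<in>B. \<forall>x\<in>B. absv (z - k) \<le> absv (z - x)" if "finite B" "B \<noteq> {}" for B z
    using that by (intro bexI[of _ "arg_min_on (\<lambda>k. absv (z - k)) B"] ballI arg_min_least arg_min_if_finite(1))
  have \<delta>near: "\<delta> z = absv (z - k)" if "k \<in> X" "\<forall>x\<in>X. absv (z - k) \<le> absv (z - x)" for z k
    unfolding \<delta>_def using that finX by (intro Min_eqI) auto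
  have \<delta>0: "\<delta> z \<ge> 0" for z unfolding \<delta>_def using finX aX by (subst Min_ge_iff) (auto simp: absv_nonneg)

  have lower: "\<mu> * t * (absv (poly Q z))\<^sup>2 \<le> \<delta> z * absv (poly ?W z)" if z: "z \<in># Z" for z
  proof -
    obtain c0 where c0: "c0 \<in> S" "\<forall>c\<in>S. absv (z - c0) \<le> absv (z - c)"
      using near[OF finS, of z] XS aX by blast
    obtain k where k: "k \<in> X" "\<forall>x\<in>X. absv (z - k) \<le> absv (z - x)"
      using near[OF finX, of z] aX by blast
    have tz: "absv (poly P z) / absv (poly Q z) = t"
      using Zval[OF z] by (simp add: absv_eq_0_iff)
    have "\<mu> * (absv (poly P z) * absv (poly Q z)) \<le> absv (z - c0) * absv (poly ?W z)"
    proof (rule absv_wronskian_ge_min_dist[OF PQ(1) P0 PQ(2), of ?d])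
      fix c c' assume "poly (P * Q) c = 0" "poly (P * Q) c' = 0"
      then have "gauss_norm P c (absv (c - c')) / gauss_norm Q c (absv (c - c')) \<in> T"
        unfolding T_def S_def by auto
      with w(3) show "gauss_norm P c (absv (c - c')) / gauss_norm Q c (absv (c - c')) \<noteq>
          absv (poly P z) / absv (poly Q z)" unfolding tz t_def by metis
    next
      fix b assume "poly ?W b = 0" "poly Q b \<noteq> 0"
      from tV[OF this] show "absv (poly P b) / absv (poly Q b) \<noteq> absv (poly P z) / absv (poly Q z)"
        unfolding tz by (simp add: absv_divide)
    qed (use PQ \<mu> Zval[OF z] c0 in \<open>auto simp: S_def\<close>)
    also have "\<dots> \<le> \<delta> z * absv (poly ?W z)"
      unfolding \<delta>near[OF k] using c0 k XS by (intro mult_right_mono absv_nonneg) auto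
    finally show ?thesis by (simp add: Zval(4)[OF z] power2_eq_square mult_ac)
  qed

  have XQ: "(\<Prod>z\<in>#Z. absv (poly Q z)) = (\<Prod>x\<in>X. absv (poly Q x))"
    unfolding Z_def prodX[symmetric] using PQ P0 G0 degG
    by (intro prod_absv_roots_eq) (auto simp: G_def)
  \<comment> \<open>At a zero of the Wronskian either \<open>Q\<close> vanishes or \<open>P\<close>
    dominates \<open>w Q\<close>, as \<open>t\<close> lies below the critical values.\<close>
  have XW: "(\<Prod>z\<in>#Z. absv (poly ?W z)) = (\<Prod>x\<in>X. absv (poly ?W x))"
    unfolding Z_def prodX[symmetric]
  proof (rule prod_absv_roots_eq[OF W0 G0 P0 degG])
    fix b assume b: "poly ?W b = 0"
    show "absv (poly G b) = absv (poly P b)"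
    proof (cases "poly Q b = 0")
      case False
      then have "absv (w * poly Q b) < absv (poly P b)"
        using tV[OF b False] by (simp add: absv_mult absv_divide t_def less_divide_eq)
      then show ?thesis using absv_diff_eq_max[of "poly P b" "w * poly Q b"] by (simp add: G_def)
    qed (simp add: G_def)
  qed

  \<comment> \<open>Products along the attachment order of the zeros\<close>
  have "X - {a} \<noteq> {}"
  proof
    assume "X - {a} = {}"
    then have "card X \<le> card {a}" by (intro card_mono) auto
    then show False using cardX PQ(4) by simp
  qed
  then obtain x2 where x2: "x2 \<in> X - {a}" "\<And>x. x \<in> X - {a} \<Longrightarrow> absv (x2 - a) \<le> absv (x - a)"
    using near[of "X - {a}" a] finX by (auto simp: absv_minus_commute)
  from prod_dist_except_nearest[OF finX aX, of x2] x2(1)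
  obtain \<rho> where \<rho>: "\<rho> x2 = absv (x2 - a)" "\<And>j. j \<in> X - {a} \<Longrightarrow> \<exists>k\<in>X - {j}. \<rho> j = absv (j - k)"
    and tree: "\<And>z k. k \<in> X \<Longrightarrow> \<forall>x\<in>X. absv (z - k) \<le> absv (z - x) \<Longrightarrow>
      (\<Prod>j\<in>X - {k}. absv (z - j)) = (\<Prod>j\<in>X - {a}. max (\<rho> j) (absv (z - j)))"
    by auto
  have \<rho>pos: "\<rho> j > 0" if j: "j \<in> X - {a}" for j
    using \<rho>(2)[OF j] by auto
  \<comment> \<open>Up to the factor \<open>?L\<close>, \<open>K j\<close> is the Gauss norm of
    \<open>G\<close> and \<open>\<kappa> j\<close> that of \<open>P\<close>, both at radius
    \<open>\<rho> j\<close> around \<open>j\<close>.\<close>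
  define K where "K j = (\<Prod>z\<in>#Z. max (\<rho> j) (absv (z - j)))" for j
  define \<kappa> where "\<kappa> j = gauss_norm P j (\<rho> j) / ?L" for j
  have \<kappa>pos: "\<kappa> j > 0" if "j \<in> X - {a}" for j
    unfolding \<kappa>_def using gauss_norm_pos[OF P0 \<rho>pos[OF that]] L0 by simp
  have K: "\<kappa> j \<le> K j" "t * gauss_norm Q j (\<rho> j) / ?L \<le> K j" if j: "j \<in> X - {a}" for j
  proof -
    obtain k where k: "k \<in> X - {j}" "\<rho> j = absv (j - k)" using \<rho>(2)[OF j] by blast
    have "gauss_norm P j (\<rho> j) / gauss_norm Q j (\<rho> j) \<in> T"
      using j k XS by (auto simp: T_def)
    then have "gauss_norm P j (absv (j - k)) \<noteq> absv w * gauss_norm Q j (absv (j - k))"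
      using w(3) gauss_norm_pos[OF PQ(2) \<rho>pos[OF j], of j] k by auto
    from gauss_norm_diff_smult_ge[OF P0 PQ(2) G0[unfolded G_def] _ this] k
    have "gauss_norm P j (\<rho> j) \<le> gauss_norm G j (\<rho> j)"
      "t * gauss_norm Q j (\<rho> j) \<le> gauss_norm G j (\<rho> j)"
      by (auto simp: G_def t_def)
    moreover have "gauss_norm G j (\<rho> j) = ?L * K j"
      unfolding gauss_norm_def K_def degG(2) Z_def by (simp add: absv_minus_commute)
    ultimately show "\<kappa> j \<le> K j" "t * gauss_norm Q j (\<rho> j) / ?L \<le> K j"
      using L0 by (simp_all add: \<kappa>_def divide_le_eq mult.commute)
  qed

  have Kpos: "K j > 0" if "j \<in> X - {a}" for j
    using \<kappa>pos[OF that] K(1)[OF that] by linarith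

  define F where "F = gauss_norm P x2 (\<rho> x2) / gauss_norm Q x2 (\<rho> x2)"
  have F0: "F > 0" unfolding F_def
    using gauss_norm_pos \<rho>pos[OF x2(1)] P0 PQ(2) by simp
  \<comment> \<open>The bound through \<open>Q\<close> is spent at \<open>x2\<close>, where it gains
    \<open>t / F\<close>; elsewhere \<open>\<kappa> j \<le> K j\<close> is used.\<close>
  have prodK: "t / F * (\<Prod>j\<in>X - {a}. \<kappa> j) \<le> (\<Prod>j\<in>X - {a}. K j)"
  proof -
    have "t * gauss_norm Q x2 (\<rho> x2) / ?L = t / F * \<kappa> x2"
      using F0 gauss_norm_pos[OF PQ(2) \<rho>pos[OF x2(1)], of x2] gauss_norm_pos[OF P0 \<rho>pos[OF x2(1)], of x2]
      by (simp add: F_def \<kappa>_def)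
    then have "t / F * \<kappa> x2 \<le> K x2" using K(2)[OF x2(1)] by simp
    moreover have "(\<Prod>j\<in>X - {a} - {x2}. \<kappa> j) \<le> (\<Prod>j\<in>X - {a} - {x2}. K j)"
      using K(1) \<kappa>pos by (intro prod_mono) (auto intro: less_imp_le)
    ultimately have "t / F * \<kappa> x2 * (\<Prod>j\<in>X - {a} - {x2}. \<kappa> j) \<le> K x2 * (\<Prod>j\<in>X - {a} - {x2}. K j)"
      using \<kappa>pos Kpos x2(1)
      by (intro mult_mono) (auto intro!: prod_nonneg intro: less_imp_le)
    then show ?thesis
      using finX x2(1) by (simp add: prod.remove[of "X - {a}" x2] mult.assoc)
  qed

  \<comment> \<open>The attachment identity \<open>tree\<close> is applied at the points
    \<open>x\<close> of \<open>X\<close>, each its own nearest point.\<close>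
  have prod\<kappa>: "(\<Prod>x\<in>X. absv (poly ?W x)) =
      ?L ^ ?d * (\<Prod>j\<in>X - {a}. \<kappa> j) * (\<Prod>x\<in>X. absv (poly Q x))"
  proof -
    have "(\<Prod>j\<in>X - {a}. \<kappa> j) = (\<Prod>j\<in>X - {a}. \<Prod>x\<in>X. max (\<rho> j) (absv (x - j)))"
      using L0 by (intro prod.cong) (simp_all add: \<kappa>_def gauss_norm_def prodX absv_minus_commute absv_eq_0_iff)
    also have "\<dots> = (\<Prod>x\<in>X. \<Prod>j\<in>X - {a}. max (\<rho> j) (absv (x - j)))" by (rule prod.swap)
    also have "\<dots> = (\<Prod>x\<in>X. \<Prod>j\<in>X - {x}. absv (x - j))"
      by (intro prod.cong refl tree[symmetric]) (auto simp: absv_nonneg)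
    finally show ?thesis
      by (simp add: derivX prod.distrib cardX)
  qed

  \<comment> \<open>For \<open>z\<close> in the fibre, \<open>\<delta> z\<close> is the factor
    omitted in \<open>tree\<close>, so the product over all of \<open>X\<close> is restored.\<close>
  have prod\<delta>: "(\<Prod>z\<in>#Z. \<delta> z) * (\<Prod>j\<in>X - {a}. K j) = (t / ?L) ^ ?d * (\<Prod>z\<in>#Z. absv (poly Q z))"
  proof -
    have "\<delta> z * (\<Prod>j\<in>X - {a}. max (\<rho> j) (absv (z - j))) = t / ?L * absv (poly Q z)" if z: "z \<in># Z" for z
    proof -
      obtain k where k: "k \<in> X" "\<forall>x\<in>X. absv (z - k) \<le> absv (z - x)"
        using near[OF finX, of z] aX by blast
      have "\<delta> z * (\<Prod>j\<in>X - {a}. max (\<rho> j) (absv (z - j))) = (\<Prod>x\<in>X. absv (z - x))"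
        unfolding \<delta>near[OF k] tree[OF k, symmetric] using finX k by (simp add: prod.remove)
      also have "\<dots> = absv (poly P z) / ?L"
        using L0 by (simp add: absv_poly[OF P0] prodX absv_eq_0_iff)
      finally show ?thesis by (simp add: Zval(4)[OF z])
    qed
    then have "(\<Prod>z\<in>#Z. \<delta> z * (\<Prod>j\<in>X - {a}. max (\<rho> j) (absv (z - j)))) =
        (\<Prod>z\<in>#Z. t / ?L * absv (poly Q z))"
      by (intro arg_cong[of _ _ prod_mset] image_mset_cong)
    moreover have "(\<Prod>z\<in>#Z. \<Prod>j\<in>X - {a}. max (\<rho> j) (absv (z - j))) = (\<Prod>j\<in>X - {a}. K j)"
      by (simp add: K_def prod_unfold_prod_mset prod_mset.swap[of _ Z])
    ultimately show ?thesis by (simp add: prod_mset.distrib sizeZ del: times_divide_eq_left)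
  qed

  \<comment> \<open>Comparison of the products\<close>
  define q \<pi> where "q = (\<Prod>x\<in>X. absv (poly Q x))" and "\<pi> = (\<Prod>j\<in>X - {a}. \<kappa> j)"
  have q0: "q > 0" unfolding q_def using common by (intro prod_pos) (auto simp: X_def)
  have \<pi>0: "\<pi> > 0" unfolding \<pi>_def using \<kappa>pos by (intro prod_pos) auto
  have "(\<mu> * t) ^ ?d * q\<^sup>2 = (\<Prod>z\<in>#Z. \<mu> * t * (absv (poly Q z))\<^sup>2)"
    by (simp add: prod_mset.distrib sizeZ q_def XQ[symmetric] power2_eq_square)
  also have "\<dots> \<le> (\<Prod>z\<in>#Z. \<delta> z * absv (poly ?W z))"
    using lower \<mu>(1) t0 by (intro prod_mset_mono_nonneg) auto
  also have "\<dots> = (\<Prod>z\<in>#Z. \<delta> z) * (?L ^ ?d * \<pi> * q)"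
    using prod\<kappa> by (simp add: prod_mset.distrib XW q_def \<pi>_def)
  finally have up: "(\<mu> * t) ^ ?d * q\<^sup>2 \<le> (\<Prod>z\<in>#Z. \<delta> z) * (?L ^ ?d * \<pi> * q)" .
  \<comment> \<open>Multiplying by \<open>prodK\<close> brings in the \<open>K j\<close>, whose
    product with the unknown \<open>\<delta> z\<close> is known by
    \<open>prod\<delta>\<close>.\<close>
  have "0 \<le> (\<mu> * t) ^ ?d * q\<^sup>2" "0 \<le> t / F * \<pi>" using \<mu>(1) t0 F0 \<pi>0 by simp_all
  with up have "(\<mu> * t) ^ ?d * q\<^sup>2 * (t / F * \<pi>) \<le>
      (\<Prod>z\<in>#Z. \<delta> z) * (?L ^ ?d * \<pi> * q) * (\<Prod>j\<in>X - {a}. K j)"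
    by (intro mult_mono[OF up prodK[folded \<pi>_def]]) linarith+
  also have "\<dots> = (t / ?L) ^ ?d * q * (?L ^ ?d * \<pi> * q)"
    using prod\<delta> XQ by (simp add: q_def mult_ac)
  also have "\<dots> = t ^ ?d * q\<^sup>2 * \<pi>"
    using L0 by (simp add: power_divide power2_eq_square absv_eq_0_iff)
  finally have "(t ^ ?d * q\<^sup>2 * \<pi>) * (\<mu> ^ ?d * (t / F)) \<le> (t ^ ?d * q\<^sup>2 * \<pi>) * 1"
    by (simp add: power_mult_distrib mult_ac)
  moreover have "t ^ ?d * q\<^sup>2 * \<pi> > 0" using t0 q0 \<pi>0 by simp
  ultimately have "\<mu> ^ ?d * (t / F) \<le> 1" by (simp only: mult_le_cancel_left_pos)
  then have "t \<le> F / \<mu> ^ ?d" using F0 \<mu> by (simp add: divide_simps mult.commute)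
  moreover have "F / \<mu> ^ ?d \<le> lo"
  proof -
    have "F \<le> r * (?L * (\<Prod>x\<in>X - {a}. absv (a - x))) / absv (poly Q a)"
      unfolding F_def \<rho>(1)
      by (rule gauss_norm_ratio_nearest_zero[OF P0 PQ(2) simple finX aX Qa x2 r])
    also have "\<dots> = r * absv (poly ?W a / (poly Q a)\<^sup>2)"
      using Qa by (simp add: derivX[OF aX] absv_divide absv_mult power2_eq_square absv_eq_0_iff)
    finally show ?thesis unfolding lo_def using \<mu> by (intro divide_right_mono) auto
  qed
  ultimately show False using w(1) by (simp add: t_def)
qed

end

theorem theorem1p4:
  fixes absv :: "'a::alg_closed_field \<Rightarrow> real"
    and d :: nat
    and \<phi> :: "'a poly fract"
    and a :: 'a
    and \<epsilon> :: real
    and r :: ereal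
  assumes "complete_nonarch_absolute_value absv"
    and "d \<ge> 2"
    and "CHAR('a) = 0 \<or> CHAR('a) > d"
    and "\<epsilon> = Min {absv (of_nat m) ^ d | m. 1 \<le> m \<and> m \<le> d}"
    and "rat_degree \<phi> = d"
    and "rat_map \<phi> Infty = Infty"
    and "rat_map \<phi> (Fin a) \<noteq> Infty"
    and "r = largest_radius absv \<phi> a"
  shows "\<exists>\<beta> w. critical_point absv \<phi> \<beta> \<and> rat_map \<phi> \<beta> = Fin w \<and>
    ereal (absv (w - rat_eval \<phi> a)) \<le>
      ereal (inverse \<epsilon>) * r * ereal (absv (rat_eval (rat_deriv \<phi>) a))"
proof -
  interpret complete_nonarch_absolute_value absv by fact
  interpret alg_closed_absv absv ..
  define N Q where "N = rat_num \<phi>" and "Q = rat_den \<phi>"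
  let ?W = "wronskian N Q"
  have degQ: "degree Q < degree N"
    using assms(6) by (auto simp: N_def Q_def split: if_splits)
  then have degN: "degree N = d"
    using assms(5) by (simp add: rat_degree_def N_def Q_def)
  have Qa: "poly Q a \<noteq> 0" using assms(7) by (auto simp: Q_def split: if_splits)
  have Q0: "Q \<noteq> 0" unfolding Q_def by (rule rat_den_nonzero)
  have copN: "coprime N Q" unfolding N_def Q_def by (rule rat_coprime)
  have char: "(of_nat m :: 'a) \<noteq> 0" if "1 \<le> m" "m \<le> d" for m
    using assms(3) that dvd_imp_le[of "CHAR('a)" m] by (auto simp: of_nat_eq_0_iff_char_dvd)
  have W0: "?W \<noteq> 0"
    using wronskian_nonzero[OF copN Q0] char[of d] degN assms(2) by auto
  have crit: "critical_point absv \<phi> (Fin b)" "rat_map \<phi> (Fin b) = Fin (poly N b / poly Q b)"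
    if "poly ?W b = 0" "poly Q b \<noteq> 0" for b
    using critical_point_wronskian_root[of \<phi> b] W0 degQ that
    by (simp_all add: N_def Q_def rat_eval_def)
  define v where "v = rat_eval \<phi> a"
  have v: "v = poly N a / poly Q a" by (simp add: v_def rat_eval_def N_def Q_def)
  have D: "rat_eval (rat_deriv \<phi>) a = poly ?W a / (poly Q a)\<^sup>2"
    using rat_eval_Fract(2)[of "Q\<^sup>2" a ?W] Qa by (simp add: rat_deriv_def wronskian_def N_def Q_def)
  show ?thesis
  proof (cases "poly ?W a = 0")
    \<comment> \<open>Here \<open>a\<close> itself is critical; the factor
      \<open>\<phi>'(a) = 0\<close> also settles an infinite \<open>r\<close>.\<close>
    case True
    then show ?thesis using crit[of a] Qa v D
      by (intro exI[of _ "Fin a"] exI[of _ v]) (simp add: v_def[symmetric] flip: zero_ereal_def)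
  next
    case False
    \<comment> \<open>Subtracting \<open>\<phi>(a)\<close> leaves the Wronskian unchanged.\<close>
    define P where "P = N - smult v Q"
    have W: "wronskian P Q = ?W" by (simp add: P_def wronskian_diff_smult)
    have degP: "degree P = d" using diff_smult_lower_degree(1)[OF degQ] degN by (simp add: P_def)
    then have P0: "P \<noteq> 0" using assms(2) by auto
    have Pa: "poly P a = 0" using Qa by (simp add: P_def v)
    have cop: "coprime P Q"
    proof (rule coprimeI)
      fix c assume c: "c dvd P" "c dvd Q"
      then have "c dvd P + smult v Q" by (intro dvd_add dvd_smult)
      then have "c dvd N" by (simp add: P_def)
      with copN c show "is_unit c" by (meson coprime_common_divisor)
    qed
    define S where "S = {c. poly (P * Q) c = 0} - {a}"
    have finS: "finite S" unfolding S_def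
      using P0 Q0 by (intro finite_Diff poly_roots_finite) simp
    \<comment> \<open>Were \<open>a\<close> the only zero or pole, it would be a zero of
      \<open>P\<close> of multiplicity \<open>d \<ge> 2\<close> and the Wronskian would vanish
      there.\<close>
    have "S \<noteq> {}"
    proof
      assume "S = {}"
      then have roots: "x = a" if "x \<in># proots P" for x
        using that P0 by (auto simp: S_def)
      then have "proots P = replicate_mset (size (proots P)) a"
        by (intro set_mset_subset_singletonD) blast
      then have "count (proots P) a = size (proots P)"
        by (metis count_replicate_mset)
      then have "count (proots P) a \<ge> 2"
        using proots_prod_linear_factors(2)[OF P0] degP assms(2) by simp
      from poly_pderiv_multiple_root[OF P0 this] have "poly (wronskian P Q) a = 0"
        by (simp add: poly_wronskian)
      with False W show False by simp
    qed
    then obtain c where c: "c \<in> S" "\<And>x. x \<in> S \<Longrightarrow> absv (c - a) \<le> absv (x - a)"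
      using arg_min_if_finite(1)[OF finS] arg_min_least[OF finS, of _ "\<lambda>x. absv (x - a)"] by metis
    \<comment> \<open>The punctured disc up to the nearest other zero or pole is admissible, so
      \<open>r' \<le> r\<close>; the claimed bound grows with \<open>r\<close>.\<close>
    define r' where "r' = absv (c - a)"
    have "Fin ` punctured_disk absv a (ereal r') \<inter> rat_map \<phi> -` {rat_map \<phi> (Fin a), Infty} = {}"
    proof -
      have "rat_map \<phi> (Fin x) \<noteq> Fin v \<and> rat_map \<phi> (Fin x) \<noteq> Infty"
        if x: "x \<in> punctured_disk absv a (ereal r')" for x
      proof -
        have "x \<notin> S" "x \<noteq> a" using x c(2)[of x] by (auto simp: punctured_disk_def r'_def)
        then have "poly P x \<noteq> 0" "poly Q x \<noteq> 0" by (auto simp: S_def)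
        then show ?thesis by (auto simp: P_def rat_eval_def N_def Q_def field_simps)
      qed
      moreover have "rat_map \<phi> (Fin a) = Fin v" using Qa by (simp add: Q_def v_def)
      ultimately show ?thesis by auto
    qed
    then have r: "ereal r' \<le> r" unfolding assms(8) largest_radius_def by (intro Sup_upper) simp

    define A where "A = (\<lambda>m. absv (of_nat m)) ` {1..d}"
    define \<mu> where "\<mu> = Min A"
    have A: "finite A" "A \<noteq> {}" using assms(2) by (auto simp: A_def)
    have "\<mu> \<in> A" unfolding \<mu>_def using A by (rule Min_in)
    then obtain m0 where m0: "1 \<le> m0" "m0 \<le> d" "\<mu> = absv (of_nat m0)" by (auto simp: A_def)
    have \<mu>0: "\<mu> > 0" using char m0 by simp
    have \<mu>le: "\<mu> \<le> absv (of_nat m)" if "1 \<le> m" "m \<le> d" for m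
      unfolding \<mu>_def using A(1) that by (intro Min_le) (auto simp: A_def)
    have \<epsilon>eq: "{absv (of_nat m) ^ d | m. 1 \<le> m \<and> m \<le> d} = (\<lambda>m. absv (of_nat m) ^ d) ` {1..d}"
      by auto
    have "\<epsilon> \<in> (\<lambda>m. absv (of_nat m) ^ d) ` {1..d}"
      unfolding assms(4) \<epsilon>eq using assms(2) by (intro Min_in) auto
    then have \<epsilon>0: "\<epsilon> > 0" using char by auto
    \<comment> \<open>\<open>\<mu>\<close> is attained at \<open>m0\<close>, so its
      \<open>d\<close>-th power is among the values of which \<open>\<epsilon>\<close> is the
      minimum.\<close>
    have \<epsilon>le: "\<epsilon> \<le> \<mu> ^ d" unfolding assms(4) \<epsilon>eq using m0 by (intro Min_le) auto

    have deg: "degree Q < degree P" "2 \<le> degree P" using degQ degN degP assms(2) by simp_all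
    have \<mu>P: "\<mu> \<le> absv (of_nat m)" if "1 \<le> m" "m \<le> degree P" for m
      using \<mu>le that degP by simp
    have c': "c \<noteq> a" "poly (P * Q) c = 0" "absv (c - a) = r'" using c(1) by (auto simp: S_def r'_def)
    have r'le: "r' \<le> absv (x - a)" if "x \<noteq> a" "poly (P * Q) x = 0" for x
      unfolding r'_def using c(2)[of x] that by (simp add: S_def)
    from exists_small_critical_value[OF cop Q0 deg \<mu>0 \<mu>P Pa c' r'le, unfolded W degP]
    obtain b where b: "poly ?W b = 0" "poly Q b \<noteq> 0"
      and le: "absv (poly P b / poly Q b) \<le> r' * absv (poly ?W a / (poly Q a)\<^sup>2) / \<mu> ^ d"
      by blast
    have "absv (poly N b / poly Q b - v) = absv (poly P b / poly Q b)"
      using b by (simp add: P_def diff_divide_distrib)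
    also note le
    also have "r' * absv (poly ?W a / (poly Q a)\<^sup>2) / \<mu> ^ d \<le>
        r' * absv (poly ?W a / (poly Q a)\<^sup>2) / \<epsilon>"
      using \<epsilon>le \<epsilon>0 by (intro divide_left_mono mult_nonneg_nonneg) (auto simp: r'_def absv_nonneg \<mu>0)
    finally have "ereal (absv (poly N b / poly Q b - v)) \<le>
        ereal (inverse \<epsilon>) * ereal r' * ereal (absv (rat_eval (rat_deriv \<phi>) a))"
      by (simp add: D field_simps)
    also have "\<dots> \<le> ereal (inverse \<epsilon>) * r * ereal (absv (rat_eval (rat_deriv \<phi>) a))"
      using r \<epsilon>0 by (intro ereal_mult_right_mono ereal_mult_left_mono) (auto simp: absv_nonneg)
    finally show ?thesis using crit[OF b] by (auto simp: v_def)
  qed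
qed

end
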